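(* Let $\varepsilon>0$ and let $m\ge 2$ be an integer. (i) For every $\delta\in(0,1)$ there is a constant $C>0$ depending only on $\varepsilon,m,\delta$ such that the following holds. Let $(p_k)_{k\ge 0}$ be a known sequence of retention probabilities in $(0,1]$ such that $p_\ell>\frac{p_k}{2}+\delta$ for all $k>\ell\ge 0$, and $p_k>\delta$ for all $k>0$. Then for every integer $n\ge 1$, every string $\mathbf{x}\in[m]^n$ can be reconstructed with probability at least $1-\varepsilon$ from $T=\lceil \exp(Cn^{1/3})\rceil$ i.i.d. samples of the deletion channel with retention probabilities $(p_k)$ applied to $\mathbf{x}$. (ii) For all $q,\tilde q\in[0,1)$ there is a constant $C>0$ depending only on $\varepsilon,m,q,\tilde q$ such that the following holds. Let the (known) deletion probabilities be $q_k=q$ for $k$ even and $q_k=\tilde q$ for $k$ odd, and let $p_k=1-q_k$. Then for every integer $n\ge 1$, every string $\mathbf{x}\in[m]^n$ can be reconstructed with probability at least $1-\varepsilon$ from $T=\lceil \exp(Cn^{1/3})\rceil$ i.i.d. samples of the deletion channel with retention probabilities $(p_k)$ applied to $\mathbf{x}$.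
   Context: Notation: $[m]=\{0,1,\dots,m-1\}$. Strings of length $n$ are indexed as $\mathbf{x}=(x_0,\dots,x_{n-1})$. Deletion channel with position-dependent retention probabilities $(p_k)$, $p_k\in(0,1]$, and deletion probabilities $q_k=1-p_k$: given an input string $\mathbf{x}=(x_0,\dots,x_{n-1})$, independently for each $k=0,\dots,n-1$ the entry $x_k$ is retained with probability $p_k$ and deleted with probability $q_k$. The output $\widetilde{\mathbf{X}}$ (a "trace" or "sample") is the string obtained by concatenating the retained entries in their original order; it is a random element of $\bigcup_{j=0}^n [m]^j$. "Every string $\mathbf{x}\in[m]^n$ can be reconstructed with probability at least $1-\varepsilon$ from $T$ i.i.d. samples" (with known retention probabilities) means: there is a function $F:\big(\bigcup_{j=0}^n[m]^j\big)^T\to[m]^n$, which may depend on $n,m,T,\varepsilon$ and on the probabilities $(p_k)$ but not on $\mathbf{x}$, such that for every $\mathbf{x}\in[m]^n$, if $\widetilde{\mathbf{X}}^{(1)},\dots,\widetilde{\mathbf{X}}^{(T)}$ are independent outputs of the deletion channel applied to $\mathbf{x}$, then $\mathbb{P}\big[F(\widetilde{\mathbf{X}}^{(1)},\dots,\widetilde{\mathbf{X}}^{(T)})=\mathbf{x}\big]\ge 1-\varepsilon$. *)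

theory Defs
  imports "HOL-Probability.Probability"
begin

text \<open>
  The alphabet $[m]$ is \<open>{..<m}\<close>; the sequence \<open>p\<close> always gives the \<^emph>\<open>retention\<close> probabilities.
\<close>

definition words :: "nat \<Rightarrow> nat \<Rightarrow> nat list set" where
  "words m n = {x \<in> lists {..<m}. length x = n}"

text \<open>
  The random function \<open>b\<close> marks the retained positions. As \<open>bernoulli_pmf\<close> clamps its parameter
  to the unit interval, the definition is only meaningful for \<open>p k \<in> {0..1}\<close>.
\<close>
definition deletion_channel :: "(nat \<Rightarrow> real) \<Rightarrow> 'a list \<Rightarrow> 'a list pmf" where
  "deletion_channel p x =
     map_pmf (\<lambda>b. nths x {k. b k}) (Pi_pmf {..<length x} False (\<lambda>k. bernoulli_pmf (p k)))"

text \<open>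
  A $T$-tuple of traces is a list of length \<open>T\<close>. The reconstruction function \<open>F\<close> is chosen before
  the string \<open>x\<close>, but may depend on all of \<open>\<epsilon>\<close>, \<open>m\<close>, \<open>n\<close>, \<open>p\<close> and \<open>T\<close>.
\<close>
definition reconstructible :: "real \<Rightarrow> nat \<Rightarrow> nat \<Rightarrow> (nat \<Rightarrow> real) \<Rightarrow> nat \<Rightarrow> bool" where
  "reconstructible \<epsilon> m n p T \<longleftrightarrow>
     (\<exists>F \<in> {ts \<in> lists (\<Union>j\<le>n. words m j). length ts = T} \<rightarrow> words m n.
        \<forall>x \<in> words m n.
          measure_pmf.prob (replicate_pmf T (deletion_channel p x)) {ts. F ts = x} \<ge> 1 - \<epsilon>)"

end

theory Submission
  imports Defs "HOL-Complex_Analysis.Conformal_Mappings"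
begin

text \<open>
  Only one-letter statistics of the traces are used: the probabilities that the letter at position
  \<open>j\<close> of a trace is \<open>c\<close>. If for any two strings one of these probabilities differs by at least
  $\exp(-Cn^{1/3})$, then $\exp(C'n^{1/3})$ samples suffice, by comparing empirical frequencies
  with their expectations (\<open>exists_reliable_test\<close>, \<open>reconstructible_if_separated\<close>).

  To find such a probability, fix a letter at which the strings first differ, in position $k_0$. The
  differences $D_j$ of the probabilities have the generating function
  $\sum_j D_j w^j = \sum_k a_k p_k \prod_{l<k} (q_l + p_l w)$ with $a_k \in \{-1,0,1\}$
  (\<open>generating_function_trace\<close>), so it is enough to bound this function from below at some \<open>w\<close>
  whose powers are not large. The substitution $w = 1 - 1/v$ turns the factors into
  $1 - p_l/v$, of modulus below 1 exactly if $\mathrm{Re}\,v > p_l/2$, and the neighbourhood of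
  $w = 1$ into the neighbourhood of infinity. After division by the factors with $l < k_0$, the
  function is the first term alone, $\pm p_{k_0}$, at $v = p_{k_0}$, where the factor with index
  $k_0$ vanishes. If a line $\mathrm{Re}\,v = b$ with $b < p_{k_0}$ lies in the region where the
  factors decay, their modulus on it is at most $1 - c/|v|^2$, and a geometric series bounds the
  function by a multiple of $|v|^2$. By the maximum principle, in
  the product form of Borwein and Erdelyi (\<open>exists_large_value_on_short_arc\<close>,
  \<open>exists_large_value_on_vertical_line\<close>), it cannot be smaller than $e^{-cL}$ on the whole part
  $|v| \ge L$ of the line. With $L$ of order $n^{1/3}$, the factors divided out and the powers
  of $w$ lose at most another factor $e^{O(n/L^2)} = e^{O(n^{1/3})}$
  (\<open>exists_large_coefficient\<close>).

  So a line is needed that separates a point where the function is not small from the region where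
  the factors do not decay. For the first part the inequality
  $p_{k_0} > p_l/2 + \delta$ is exactly this (\<open>favourable_if_dominating\<close>). For alternating
  probabilities it suffices that products of two neighbouring factors decay, and either
  $v = p_{k_0}$ or $v = p_{k_0+1}$ can be used (\<open>favourable_if_alternating\<close>).
\<close>

section \<open>Testing hypotheses by empirical frequencies\<close>

text \<open>
  The variance of a sum of independent indicators. The second claim, that the mean is right, is
  what removes the mixed term in the induction for the first.
\<close>
lemma second_moment_count:
  fixes \<mu> :: "'a pmf" and E :: "'a \<Rightarrow> bool"
  assumes fin: "finite (set_pmf \<mu>)"
  defines "p \<equiv> measure_pmf.prob \<mu> {t. E t}"
  shows "measure_pmf.expectation (replicate_pmf T \<mu>)
           (\<lambda>ts. (real (length (filter E ts)) - T * p)\<^sup>2) = T * (p * (1 - p))"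
    and "measure_pmf.expectation (replicate_pmf T \<mu>)
           (\<lambda>ts. real (length (filter E ts)) - T * p) = 0"
proof (induction T)
  case 0
  { case 1 show ?case by simp }
  { case 2 show ?case by simp }
next
  case (Suc T)
  let ?R = "replicate_pmf T \<mu>"
  let ?S = "\<lambda>ts. real (length (filter E ts)) - T * p"
  have finR: "finite (set_pmf ?R)"
    unfolding set_replicate_pmf using finite_lists_length_eq[OF fin, of T]
    by (simp add: lists_eq_set conj_commute subset_eq Ball_def)
  have int: "integrable (measure_pmf ?R) h" for h :: "'a list \<Rightarrow> real"
    by (rule integrable_measure_pmf_finite[OF finR])
  have int1: "integrable (measure_pmf \<mu>) h" for h :: "'a \<Rightarrow> real"
    by (rule integrable_measure_pmf_finite[OF fin])
  have step: "measure_pmf.expectation (replicate_pmf (Suc T) \<mu>) h =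
      measure_pmf.expectation \<mu> (\<lambda>x. measure_pmf.expectation ?R (\<lambda>ts. h (x # ts)))"
    for h :: "'a list \<Rightarrow> real"
  proof -
    have "replicate_pmf (Suc T) \<mu> = \<mu> \<bind> (\<lambda>x. map_pmf (\<lambda>ts. x # ts) ?R)"
      by (simp add: map_pmf_def)
    then show ?thesis
      using fin finR
      by (simp add: pmf_expectation_bind[of "set_pmf \<mu>"] integral_measure_pmf[of "set_pmf \<mu>"] del: replicate_pmf.simps)
  qed
  have ind: "measure_pmf.expectation \<mu> (\<lambda>x. of_bool (E x)) = p"
  proof -
    have "(\<lambda>x. of_bool (E x)) = indicat_real {t. E t}" by (auto simp: indicator_def)
    then show ?thesis by (simp add: p_def)
  qed
  have S_cons: "real (length (filter E (x # ts))) - real (Suc T) * p = ?S ts + (of_bool (E x) - p)" for x ts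
    by (simp add: algebra_simps)
  { case 1
    have "(\<lambda>x. measure_pmf.expectation ?R (\<lambda>ts. (?S ts + (of_bool (E x) - p))\<^sup>2))
        = (\<lambda>x. T * (p * (1 - p)) + (of_bool (E x) * (1 - 2 * p) + p\<^sup>2))"
    proof
      fix x
      have "measure_pmf.expectation ?R (\<lambda>ts. (?S ts + (of_bool (E x) - p))\<^sup>2)
        = measure_pmf.expectation ?R (\<lambda>ts. (?S ts)\<^sup>2 + 2 * (of_bool (E x) - p) * ?S ts + (of_bool (E x) - p)\<^sup>2)"
      proof -
        have "(y + e)\<^sup>2 = y\<^sup>2 + 2 * e * y + e\<^sup>2" for y e :: real
          by (simp add: power2_sum mult_ac)
        then show ?thesis by simp
      qed
      also have "\<dots> = T * (p * (1 - p)) + (of_bool (E x) - p)\<^sup>2"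
        by (simp only: Bochner_Integration.integral_add[OF int int] integral_mult_right_zero Suc) simp
      also have "(of_bool (E x) - p)\<^sup>2 = of_bool (E x) * (1 - 2 * p) + p\<^sup>2"
        by (simp add: power2_diff algebra_simps power2_eq_square)
      finally show "measure_pmf.expectation ?R (\<lambda>ts. (?S ts + (of_bool (E x) - p))\<^sup>2) =
        T * (p * (1 - p)) + (of_bool (E x) * (1 - 2 * p) + p\<^sup>2)" .
    qed
    moreover have "measure_pmf.expectation \<mu> (\<lambda>x. A + (of_bool (E x) * k + q)) = A + (p * k + q)" for A k q
      by (simp add: Bochner_Integration.integral_add[OF int1 int1] ind)
    ultimately have "measure_pmf.expectation \<mu> (\<lambda>x. measure_pmf.expectation ?R (\<lambda>ts. (?S ts + (of_bool (E x) - p))\<^sup>2))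
        = T * (p * (1 - p)) + (p * (1 - 2 * p) + p\<^sup>2)"
      by simp
    then show ?case
      unfolding step S_cons by (simp add: algebra_simps power2_eq_square) }
  { case 2
    show ?case
      unfolding step S_cons Bochner_Integration.integral_add[OF int int] Suc
      by (simp add: ind Bochner_Integration.integral_diff[OF int1 int1]) }
qed

lemma count_concentration:
  fixes \<mu> :: "'a pmf" and E :: "'a \<Rightarrow> bool"
  assumes fin: "finite (set_pmf \<mu>)" and "T \<ge> 1" "\<gamma> > 0"
  shows "measure_pmf.prob (replicate_pmf T \<mu>)
           {ts. \<bar>length (filter E ts) / T - measure_pmf.prob \<mu> {t. E t}\<bar> \<ge> \<gamma> / 2} \<le> 1 / (T * \<gamma>\<^sup>2)"
proof -
  let ?R = "replicate_pmf T \<mu>" and ?p = "measure_pmf.prob \<mu> {t. E t}"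
  have finR: "finite (set_pmf ?R)"
    unfolding set_replicate_pmf using finite_lists_length_eq[OF fin, of T]
    by (simp add: lists_eq_set conj_commute subset_eq Ball_def)
  have "{ts. \<bar>length (filter E ts) / T - ?p\<bar> \<ge> \<gamma> / 2}
      = {ts \<in> space (measure_pmf ?R). \<bar>length (filter E ts) - T * ?p\<bar> \<ge> T * \<gamma> / 2}"
  proof -
    have "\<bar>c / T - ?p\<bar> \<ge> \<gamma> / 2 \<longleftrightarrow> \<bar>c - T * ?p\<bar> \<ge> T * \<gamma> / 2" for c :: real
    proof -
      have "c - T * ?p = T * (c / T - ?p)" using \<open>T \<ge> 1\<close> by (simp add: field_simps)
      then have "\<bar>c - T * ?p\<bar> = T * \<bar>c / T - ?p\<bar>" by (simp add: abs_mult)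
      then show ?thesis using \<open>T \<ge> 1\<close> by (simp add: field_simps)
    qed
    then show ?thesis by simp
  qed
  also have "measure_pmf.prob ?R \<dots> \<le>
      measure_pmf.expectation ?R (\<lambda>ts. (length (filter E ts) - T * ?p)\<^sup>2) / (T * \<gamma> / 2)\<^sup>2"
    by (rule measure_pmf.second_moment_method)
      (use assms integrable_measure_pmf_finite[OF finR] in auto)
  also have "\<dots> = T * (?p * (1 - ?p)) / (T * \<gamma> / 2)\<^sup>2"
    by (simp only: second_moment_count[OF fin])
  also have "\<dots> \<le> T * (1 / 4) / (T * \<gamma> / 2)\<^sup>2"
  proof -
    have "?p * (1 - ?p) \<le> 1 / 4" using zero_le_power2[of "?p - 1/2"]
      by (simp add: power2_eq_square algebra_simps)
    then show ?thesis by (intro divide_right_mono mult_left_mono) auto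
  qed
  also have "\<dots> = 1 / (T * \<gamma>\<^sup>2)"
    using assms by (simp add: power2_eq_square field_simps)
  finally show ?thesis .
qed

text \<open>
  Choose a hypothesis \<open>x\<close> for which every empirical frequency is within \<open>\<gamma> / 2\<close> of its
  expectation under \<open>x\<close>. Two different hypotheses cannot both pass, since some event has
  probabilities under them that are \<open>\<gamma>\<close> apart; and the true one passes by Chebyshev's inequality
  and a union bound over \<open>I\<close>.
\<close>
lemma exists_reliable_test:
  fixes P :: "'x \<Rightarrow> 'a pmf" and E :: "'i \<Rightarrow> 'a \<Rightarrow> bool"
  assumes fin: "\<And>x. x \<in> X \<Longrightarrow> finite (set_pmf (P x))" and "finite I" "X \<noteq> {}"
    and "T \<ge> 1" "\<gamma> > 0"
    and sep: "\<And>x y. x \<in> X \<Longrightarrow> y \<in> X \<Longrightarrow> x \<noteq> y \<Longrightarrow>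
        \<exists>i\<in>I. \<bar>measure_pmf.prob (P x) {t. E i t} - measure_pmf.prob (P y) {t. E i t}\<bar> \<ge> \<gamma>"
  shows "\<exists>F. range F \<subseteq> X \<and> (\<forall>x\<in>X. measure_pmf.prob (replicate_pmf T (P x)) {ts. F ts = x}
            \<ge> 1 - card I / (T * \<gamma>\<^sup>2))"
proof -
  define far where "far x i ts \<longleftrightarrow>
    \<bar>length (filter (E i) ts) / T - measure_pmf.prob (P x) {t. E i t}\<bar> \<ge> \<gamma> / 2" for x i ts
  \<comment> \<open>The implication only serves to give \<open>F\<close> a value in \<open>X\<close> when no hypothesis passes.\<close>
  define F where "F ts = (SOME x. x \<in> X \<and> ((\<exists>x\<in>X. \<forall>i\<in>I. \<not> far x i ts) \<longrightarrow> (\<forall>i\<in>I. \<not> far x i ts)))" for ts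
  have F: "F ts \<in> X \<and> ((\<exists>x\<in>X. \<forall>i\<in>I. \<not> far x i ts) \<longrightarrow> (\<forall>i\<in>I. \<not> far (F ts) i ts))" for ts
    unfolding F_def by (rule someI_ex) (use \<open>X \<noteq> {}\<close> in blast)
  have F_eq: "F ts = x" if "x \<in> X" "\<forall>i\<in>I. \<not> far x i ts" for x ts
  proof (rule ccontr)
    assume "F ts \<noteq> x"
    have FX: "F ts \<in> X" "\<forall>i\<in>I. \<not> far (F ts) i ts" using F that by blast+
    from sep[OF FX(1) that(1) \<open>F ts \<noteq> x\<close>] obtain i where i: "i \<in> I"
      "\<bar>measure_pmf.prob (P (F ts)) {t. E i t} - measure_pmf.prob (P x) {t. E i t}\<bar> \<ge> \<gamma>"
      by blast
    moreover have "\<not> far x i ts" "\<not> far (F ts) i ts" using i that FX by auto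
    ultimately show False unfolding far_def by linarith
  qed
  have "measure_pmf.prob (replicate_pmf T (P x)) {ts. F ts = x} \<ge> 1 - card I / (T * \<gamma>\<^sup>2)"
    if "x \<in> X" for x
  proof -
    let ?R = "replicate_pmf T (P x)"
    have "measure_pmf.prob ?R (- {ts. F ts = x}) \<le> measure_pmf.prob ?R (\<Union>i\<in>I. {ts. far x i ts})"
      by (rule measure_pmf.finite_measure_mono) (use F_eq[OF that] in auto)
    also have "\<dots> \<le> (\<Sum>i\<in>I. measure_pmf.prob ?R {ts. far x i ts})"
      by (rule measure_pmf.finite_measure_subadditive_finite) (use \<open>finite I\<close> in auto)
    also have "\<dots> \<le> (\<Sum>i\<in>I. 1 / (T * \<gamma>\<^sup>2))"
      unfolding far_def by (intro sum_mono count_concentration fin that assms)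
    finally have "measure_pmf.prob ?R (- {ts. F ts = x}) \<le> card I / (T * \<gamma>\<^sup>2)" by simp
    moreover have "measure_pmf.prob ?R (- {ts. F ts = x}) = 1 - measure_pmf.prob ?R {ts. F ts = x}"
      using measure_pmf.prob_compl[of "{ts. F ts = x}" ?R] by (simp add: Compl_eq_Diff_UNIV)
    ultimately show ?thesis by linarith
  qed
  then show ?thesis using F by blast
qed

section \<open>The generating function of a trace\<close>

lemma deletion_channel_snoc:
  "deletion_channel p (xs @ [c]) =
     deletion_channel p xs \<bind> (\<lambda>t. map_pmf (\<lambda>b. if b then t @ [c] else t) (bernoulli_pmf (p (length xs))))"
proof -
  have upd: "nths (xs @ [c]) {k. (f(length xs := y)) k} = (if y then nths xs {k. f k} @ [c] else nths xs {k. f k})"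
    for f and y :: bool
  proof -
    have "nths xs {k. (f(length xs := y)) k} = nths xs {k. f k}"
      unfolding nths_def by (intro arg_cong[where f = "map fst"] filter_cong) (auto simp: in_set_zip)
    then show ?thesis by (simp add: nths_append nths_singleton)
  qed
  have "{..<length (xs @ [c])} = insert (length xs) {..<length xs}"
    by auto
  then show ?thesis
    unfolding deletion_channel_def
    by (simp add: Pi_pmf_insert' map_bind_pmf bind_map_pmf upd map_pmf_def bind_assoc_pmf bind_return_pmf
         bind_commute_pmf[of "bernoulli_pmf _"])
qed

lemma finite_set_deletion_channel: "finite (set_pmf (deletion_channel p x))"
  unfolding deletion_channel_def by (auto simp: set_map_pmf set_Pi_pmf intro!: finite_imageI finite_PiE_dflt)

lemma length_trace: "t \<in> set_pmf (deletion_channel p x) \<Longrightarrow> length t \<le> length x"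
proof -
  have "card {i. i < length x \<and> b i} \<le> length x" for b
    using card_mono[of "{..<length x}" "{i. i < length x \<and> b i}"] by auto
  then show "t \<in> set_pmf (deletion_channel p x) \<Longrightarrow> length t \<le> length x"
    by (auto simp: deletion_channel_def length_nths)
qed

lemma expectation_deletion_channel_snoc:
  fixes h :: "'a list \<Rightarrow> complex"
  assumes "0 \<le> p (length xs)" "p (length xs) \<le> 1"
  shows "measure_pmf.expectation (deletion_channel p (xs @ [c])) h =
    of_real (p (length xs)) * measure_pmf.expectation (deletion_channel p xs) (\<lambda>t. h (t @ [c])) +
    of_real (1 - p (length xs)) * measure_pmf.expectation (deletion_channel p xs) h"
proof -
  let ?D = "deletion_channel p xs"
  have fin: "finite (set_pmf ?D)" by (rule finite_set_deletion_channel)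
  show ?thesis
    unfolding deletion_channel_snoc
    by (subst pmf_expectation_bind[OF fin _ order_refl])
      (use assms fin in \<open>auto simp: integral_measure_pmf[OF fin] integral_measure_pmf[of "UNIV :: bool set"]
        UNIV_bool sum.distrib sum_subtractf sum_distrib_left scaleR_conv_of_real algebra_simps\<close>)
qed

lemma expectation_power_length_trace:
  fixes w :: complex
  assumes "\<And>k. 0 \<le> p k \<and> p k \<le> 1"
  shows "measure_pmf.expectation (deletion_channel p xs) (\<lambda>t. w ^ length t)
    = (\<Prod>l<length xs. of_real (1 - p l) + of_real (p l) * w)"
proof (induction xs rule: rev_induct)
  case Nil
  then show ?case by (simp add: deletion_channel_def)
next
  case (snoc c xs)
  then show ?case
    using assms by (simp add: expectation_deletion_channel_snoc algebra_simps)
qed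

lemma expectation_trace_indicator:
  fixes w :: complex
  assumes "\<And>k. 0 \<le> p k \<and> p k \<le> 1"
  shows "measure_pmf.expectation (deletion_channel p xs)
      (\<lambda>t. \<Sum>j<length t. of_bool (t ! j = a) * w ^ j)
    = (\<Sum>k<length xs. of_bool (xs ! k = a) * of_real (p k) *
        (\<Prod>l<k. of_real (1 - p l) + of_real (p l) * w))"
proof (induction xs rule: rev_induct)
  case Nil
  then show ?case by (simp add: deletion_channel_def)
next
  case (snoc c xs)
  let ?g = "\<lambda>t. \<Sum>j<length t. of_bool (t ! j = a) * w ^ j" and ?D = "deletion_channel p xs"
  have g: "?g (t @ [c]) = ?g t + of_bool (c = a) * w ^ length t" for t
    by (simp add: nth_append)
  have int: "integrable (measure_pmf ?D) h" for h :: "'a list \<Rightarrow> complex"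
    by (rule integrable_measure_pmf_finite[OF finite_set_deletion_channel])
  have "measure_pmf.expectation ?D (\<lambda>t. ?g (t @ [c])) =
      measure_pmf.expectation ?D ?g + of_bool (c = a) * (\<Prod>l<length xs. of_real (1 - p l) + of_real (p l) * w)"
    unfolding g Bochner_Integration.integral_add[OF int int]
    by (simp add: expectation_power_length_trace[OF assms])
  then have "measure_pmf.expectation (deletion_channel p (xs @ [c])) ?g =
      measure_pmf.expectation ?D ?g +
      of_real (p (length xs)) * of_bool (c = a) * (\<Prod>l<length xs. of_real (1 - p l) + of_real (p l) * w)"
    unfolding expectation_deletion_channel_snoc[OF conjunct1[OF assms] conjunct2[OF assms]]
    by (simp only: of_real_diff of_real_1) (simp add: algebra_simps del: sum_of_bool_mult_eq)
  then show ?case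
    unfolding snoc by (simp add: nth_append)
qed

text \<open>
  A retained letter at position \<open>k\<close> lands at the position \<open>j\<close> that counts the retained letters
  before it, so $w^j$ is the product of $w$ over the retained positions before \<open>k\<close>, whose
  expectation factorises.
\<close>
lemma generating_function_trace:
  fixes w :: complex
  assumes p: "\<And>k. 0 \<le> p k \<and> p k \<le> 1"
  shows "(\<Sum>j<length xs. of_real (measure_pmf.prob (deletion_channel p xs) {t. j < length t \<and> t ! j = a}) * w ^ j)
    = (\<Sum>k<length xs. of_bool (xs ! k = a) * of_real (p k) *
        (\<Prod>l<k. of_real (1 - p l) + of_real (p l) * w))"
proof -
  let ?D = "deletion_channel p xs" and ?E = "\<lambda>j. {t. j < length t \<and> t ! j = a}"
  have int: "integrable (measure_pmf ?D) h" for h :: "'a list \<Rightarrow> complex"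
    by (rule integrable_measure_pmf_finite[OF finite_set_deletion_channel])
  have "(\<Sum>j<length xs. of_real (measure_pmf.prob ?D (?E j)) * w ^ j)
    = (\<Sum>j<length xs. measure_pmf.expectation ?D (\<lambda>t. indicator (?E j) t * w ^ j))"
  proof (intro sum.cong refl)
    fix j
    have "of_real (measure_pmf.prob ?D (?E j)) = measure_pmf.expectation ?D (\<lambda>t. of_real (indicator (?E j) t) :: complex)"
      unfolding integral_complex_of_real by simp
    then show "of_real (measure_pmf.prob ?D (?E j)) * w ^ j =
        measure_pmf.expectation ?D (\<lambda>t. indicator (?E j) t * w ^ j)"
      by (simp add: of_real_indicator)
  qed
  also have "\<dots> = measure_pmf.expectation ?D (\<lambda>t. \<Sum>j<length xs. indicator (?E j) t * w ^ j)"
    by (rule Bochner_Integration.integral_sum[symmetric]) (rule int)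
  also have "\<dots> = measure_pmf.expectation ?D (\<lambda>t. \<Sum>j<length t. of_bool (t ! j = a) * w ^ j)"
  proof (intro integral_cong_AE AE_pmfI)
    fix t assume "t \<in> set_pmf ?D"
    then have "length t \<le> length xs" by (rule length_trace)
    then show "(\<Sum>j<length xs. indicator (?E j) t * w ^ j) = (\<Sum>j<length t. of_bool (t ! j = a) * w ^ j)"
      by (intro sum.mono_neutral_cong_right) (auto simp: indicator_def)
  qed auto
  finally show ?thesis by (simp only: expectation_trace_indicator[OF p])
qed

section \<open>Reconstruction from separated letter probabilities\<close>

definition separated :: "real \<Rightarrow> nat \<Rightarrow> nat \<Rightarrow> (nat \<Rightarrow> real) \<Rightarrow> nat list \<Rightarrow> nat list \<Rightarrow> bool" where
  "separated \<gamma> m n p x y \<longleftrightarrow> (\<exists>j<n. \<exists>c<m.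
     \<bar>measure_pmf.prob (deletion_channel p x) {t. j < length t \<and> t ! j = c} -
      measure_pmf.prob (deletion_channel p y) {t. j < length t \<and> t ! j = c}\<bar> \<ge> \<gamma>)"

lemma separated_antimono: "separated \<gamma> m n p x y \<Longrightarrow> \<gamma>' \<le> \<gamma> \<Longrightarrow> separated \<gamma>' m n p x y"
  unfolding separated_def by (meson order_trans)

lemma le_exp_cube_root: "real n \<le> exp (3 * real n powr (1/3))"
proof -
  let ?N = "real n powr (1/3)"
  have "n = ?N ^ 3" by (cases "n = 0") (simp_all add: powr_power)
  also have "\<dots> \<le> exp ?N ^ 3"
  proof (rule power_mono)
    show "?N \<le> exp ?N" using exp_ge_add_one_self[of ?N] by linarith
  qed simp
  also have "\<dots> = exp (3 * ?N)" by (simp flip: exp_of_nat_mult)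
  finally show ?thesis .
qed

text \<open>
  There are only \<open>n * m\<close> events to test, and the separation is $\exp(-Cn^{1/3})$; so the number of
  samples needed, $nm\exp(2Cn^{1/3})/\varepsilon$, is again of the form $\exp(C'n^{1/3})$.
\<close>
lemma reconstructible_if_separated:
  assumes "\<epsilon> > 0" "m \<ge> 1" "C \<ge> 0"
  obtains C' where "C' > 0"
    and "\<And>n p. \<lbrakk>n \<ge> 1;
        \<forall>x\<in>words m n. \<forall>y\<in>words m n. x \<noteq> y \<longrightarrow> separated (exp (- C * real n powr (1/3))) m n p x y\<rbrakk>
      \<Longrightarrow> reconstructible \<epsilon> m n p (nat \<lceil>exp (C' * real n powr (1/3))\<rceil>)"
proof -
  define \<kappa> where "\<kappa> = \<bar>ln (m / \<epsilon>)\<bar>"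
  define C' where "C' = 3 + 2 * C + \<kappa>"
  have "\<kappa> \<ge> 0" by (simp add: \<kappa>_def)
  then have "C' > 0" using assms by (simp add: C'_def)
  have "reconstructible \<epsilon> m n p (nat \<lceil>exp (C' * real n powr (1/3))\<rceil>)"
    if n: "n \<ge> 1" and sep: "\<forall>x\<in>words m n. \<forall>y\<in>words m n. x \<noteq> y \<longrightarrow>
       separated (exp (- C * real n powr (1/3))) m n p x y" for n p
  proof -
    define N where "N = real n powr (1/3)"
    have N1: "N \<ge> 1" unfolding N_def using n by (intro ge_one_powr_ge_zero) auto
    define \<gamma> where "\<gamma> = exp (- C * N)"
    define T where "T = nat \<lceil>exp (C' * N)\<rceil>"
    have T: "T \<ge> exp (C' * N)" unfolding T_def by linarith
    then have "real T > 0" using exp_gt_zero[of "C' * N"] by linarith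
    then have T1: "T \<ge> 1" by simp
    have "replicate n 0 \<in> words m n" using assms by (auto simp: words_def)
    then have ne: "words m n \<noteq> {}" by blast
    define E :: "nat \<times> nat \<Rightarrow> nat list \<Rightarrow> bool"
      where "E i t \<longleftrightarrow> fst i < length t \<and> t ! fst i = snd i" for i t
    have sep_E: "\<exists>i\<in>{..<n} \<times> {..<m}. \<bar>measure_pmf.prob (deletion_channel p x) {t. E i t} -
        measure_pmf.prob (deletion_channel p y) {t. E i t}\<bar> \<ge> \<gamma>"
      if xy: "x \<in> words m n" "y \<in> words m n" "x \<noteq> y" for x y
    proof -
      have "separated \<gamma> m n p x y" using sep xy unfolding \<gamma>_def N_def by blast
      then obtain j c where "j < n" "c < m"
        "\<bar>measure_pmf.prob (deletion_channel p x) {t. j < length t \<and> t ! j = c} -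
          measure_pmf.prob (deletion_channel p y) {t. j < length t \<and> t ! j = c}\<bar> \<ge> \<gamma>"
        unfolding separated_def by blast
      then show ?thesis by (intro bexI[of _ "(j, c)"]) (simp_all add: E_def)
    qed
    have fin: "finite ({..<n} \<times> {..<m})" and "\<gamma> > 0" by (simp_all add: \<gamma>_def)
    obtain F where F: "range F \<subseteq> words m n"
      "\<forall>x\<in>words m n. measure_pmf.prob (replicate_pmf T (deletion_channel p x)) {ts. F ts = x}
            \<ge> 1 - card ({..<n} \<times> {..<m}) / (T * \<gamma>\<^sup>2)"
      using exists_reliable_test[of "words m n" "deletion_channel p", OF finite_set_deletion_channel
          fin ne T1 \<open>\<gamma> > 0\<close> sep_E] by blast
    have "card ({..<n} \<times> {..<m}) / (T * \<gamma>\<^sup>2) \<le> \<epsilon>"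
    proof -
      have "m / \<epsilon> = exp (ln (m / \<epsilon>))" using assms by simp
      also have "\<dots> \<le> exp (\<kappa> * N)"
      proof -
        have "ln (m / \<epsilon>) \<le> \<kappa> * 1" by (simp add: \<kappa>_def)
        also have "\<dots> \<le> \<kappa> * N" using N1 \<open>\<kappa> \<ge> 0\<close> by (rule mult_left_mono)
        finally show ?thesis by simp
      qed
      finally have "n * (m / \<epsilon>) \<le> exp (3 * N) * exp (\<kappa> * N)"
        using le_exp_cube_root[of n] assms by (intro mult_mono) (auto simp: N_def)
      also have "\<dots> = exp (C' * N) * \<gamma>\<^sup>2"
        by (simp add: C'_def \<gamma>_def algebra_simps flip: exp_add exp_of_nat_mult)
      also have "\<dots> \<le> T * \<gamma>\<^sup>2" using T by (intro mult_right_mono) auto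
      finally show ?thesis
        using assms T1 by (simp add: field_simps \<gamma>_def)
    qed
    then have "measure_pmf.prob (replicate_pmf T (deletion_channel p x)) {ts. F ts = x} \<ge> 1 - \<epsilon>"
      if "x \<in> words m n" for x
      using bspec[OF F(2) that] by linarith
    then show ?thesis
      unfolding reconstructible_def T_def[unfolded N_def, symmetric] using F(1) by (intro bexI[of _ F]) auto
  qed
  then show thesis by (rule that[OF \<open>C' > 0\<close>])
qed

section \<open>Large values near the boundary of a disc and of a half plane\<close>

text \<open>
  Rotate \<open>f\<close> by all multiples of $2\pi/M$ and multiply. The product is $f(0)^M$ at the origin, so by
  the maximum principle it is at least that large somewhere on the unit circle. At such a point
  one of the $M$ rotations lands in the short arc around 1, and the other factors are at most \<open>K\<close>.
\<close>
lemma exists_large_value_on_short_arc: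
  fixes f :: "complex \<Rightarrow> complex"
  assumes hol: "f holomorphic_on ball 0 1" and cont: "continuous_on (cball 0 1) f"
    and bound: "\<And>z. norm z = 1 \<Longrightarrow> norm (f z) \<le> K"
    and "M \<ge> 1"
  shows "\<exists>\<theta>. \<bar>\<theta>\<bar> \<le> pi / M \<and> norm (f 0) ^ M \<le> norm (f (cis \<theta>)) * K ^ (M - 1)"
proof -
  define F where "F z = (\<Prod>j<M. f (cis (2 * pi * j / M) * z))" for z
  have holF: "F holomorphic_on ball 0 1"
    unfolding F_def
    by (intro holomorphic_intros holomorphic_on_compose_gen[OF _ hol, unfolded o_def])
      (auto simp: norm_mult)
  have contF: "continuous_on (cball 0 1) F"
    unfolding F_def
    by (intro continuous_intros continuous_on_compose2[OF cont]) (auto simp: norm_mult)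
  have "continuous_on (sphere 0 1) (\<lambda>z. norm (F z))"
    by (intro continuous_intros continuous_on_subset[OF contF]) auto
  then obtain z where z: "norm z = 1" and zmax: "\<And>y. norm y = 1 \<Longrightarrow> norm (F y) \<le> norm (F z)"
    using continuous_attains_sup[of "sphere 0 1" "\<lambda>z. norm (F z)"] by auto
  have "norm (F 0) \<le> norm (F z)"
    by (rule maximum_modulus_frontier[of F "ball 0 1"]) (use holF contF zmax in auto)
  moreover have "norm (F 0) = norm (f 0) ^ M"
    by (simp add: F_def norm_power)
  ultimately have F_large: "norm (f 0) ^ M \<le> norm (F z)" by simp
  obtain \<alpha> where \<alpha>: "z = cis \<alpha>"
    using z by (metis cis_Arg_unique complex_norm_eq_1_exp cis_conv_exp mult.commute)
  \<comment> \<open>Rotating \<open>z\<close> by \<open>N\<close> steps of length $2\pi/M$ brings its argument as close to 0 as possible.\<close>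
  define N where "N = round (- \<alpha> * M / (2 * pi))"
  define j where "j = nat (N mod M)"
  have jM: "j < M" using \<open>M \<ge> 1\<close> by (simp add: j_def nat_less_iff)
  define \<theta> where "\<theta> = \<alpha> + 2 * pi * N / M"
  have "\<bar>of_int N - (- \<alpha> * M / (2 * pi))\<bar> \<le> 1/2"
    unfolding N_def by (rule of_int_round_abs_le)
  moreover have "\<theta> = (2 * pi / M) * (of_int N - (- \<alpha> * M / (2 * pi)))"
    using \<open>M \<ge> 1\<close> by (simp add: \<theta>_def field_simps)
  ultimately have "\<bar>\<theta>\<bar> \<le> (2 * pi / M) * (1/2)"
    by (simp add: abs_mult mult_left_mono del: times_divide_eq_left times_divide_eq_right)
  then have \<theta>_small: "\<bar>\<theta>\<bar> \<le> pi / M" by simp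
  have "N = int j + int M * (N div int M)"
    using \<open>M \<ge> 1\<close> by (simp add: j_def)
  then have "of_int N = real j + real M * of_int (N div int M)"
    by (metis of_int_add of_int_mult of_int_of_nat_eq)
  then have "\<theta> = \<alpha> + 2 * pi * j / M + 2 * pi * of_int (N div int M)"
    using \<open>M \<ge> 1\<close> by (simp add: \<theta>_def field_simps)
  then have "cis \<theta> = cis (\<alpha> + 2 * pi * j / M)"
    by (simp flip: cis_mult)
  then have cis\<theta>: "cis (2 * pi * j / M) * z = cis \<theta>"
    by (simp add: \<alpha> cis_mult add.commute)
  have "norm (F z) = norm (f (cis \<theta>)) * (\<Prod>i\<in>{..<M} - {j}. norm (f (cis (2 * pi * i / M) * z)))"
    using jM by (simp add: F_def cis\<theta> norm_mult prod_norm[symmetric] prod.remove[of _ j])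
  also have "\<dots> \<le> norm (f (cis \<theta>)) * (\<Prod>i\<in>{..<M} - {j}. K)"
    by (intro mult_left_mono prod_mono) (auto intro!: bound simp: norm_mult z)
  also have "(\<Prod>i\<in>{..<M} - {j}. K) = K ^ (M - 1)"
    using jM by simp
  finally show ?thesis using F_large \<theta>_small by (intro exI[of _ \<theta>]) auto
qed

text \<open>
  The half plane $\mathrm{Re}\,v \ge b$ is the image of the unit disc under
  $u \mapsto b + d\,(1+u)/(1-u)$, which sends 0 to \<open>b + d\<close> and short arcs around 1 to the far part
  of the boundary line. The allowed growth \<open>(norm v)\<^sup>2\<close> on that line is absorbed by the
  factor $(1-u)^2$, which is 1 at \<open>u = 0\<close>: since $|(1-u)\,v| \le 2(b + d) \le 2$ on the circle, the
  previous lemma applies with the bound \<open>4 * K\<close>. Removing the factor again costs at most another 4.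
\<close>
lemma exists_large_value_on_vertical_line:
  fixes g :: "complex \<Rightarrow> complex" and b d K :: real and M :: nat
  assumes hol: "g holomorphic_on UNIV"
    and "b > 0" "d > 0" "b + d \<le> 1" "K \<ge> 0"
    and bound: "\<And>v. Re v = b \<Longrightarrow> norm (g (1 / v)) \<le> K * (norm v)\<^sup>2"
    and nz: "g (1 / of_real (b + d)) \<noteq> 0"
    and M: "M \<ge> 8 / d"
  shows "\<exists>v. Re v = b \<and> norm v \<ge> d * M / 2 \<and>
           norm (g (1 / of_real (b + d))) ^ M \<le> 4 * norm (g (1 / v)) * (4 * K) ^ (M - 1)"
proof -
  \<comment> \<open>\<open>s u\<close> is $1/v$; unlike \<open>v\<close> it is continuous at \<open>u = 1\<close>.\<close>
  define D :: "complex \<Rightarrow> complex" where "D u = of_real b * (1 - u) + of_real d * (1 + u)" for u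
  define s where "s u = (1 - u) / D u" for u
  define f where "f u = (1 - u)\<^sup>2 * g (s u)" for u
  have D0: "D u \<noteq> 0" if "norm u \<le> 1" for u
  proof
    assume "D u = 0"
    then have "of_real (b + d) = of_real (b - d) * u"
      by (simp add: D_def algebra_simps)
    then have "norm (of_real (b + d) :: complex) = norm (of_real (b - d) * u)" by simp
    then have "b + d = \<bar>b - d\<bar> * norm u"
      unfolding norm_mult norm_of_real using assms by simp
    also have "\<dots> \<le> \<bar>b - d\<bar> * 1" using that by (intro mult_left_mono) auto
    finally show False using assms by auto
  qed
  have D_le: "norm (D u) \<le> 2" if "norm u \<le> 1" for u
  proof -
    have "norm (D u) \<le> b * norm (1 - u) + d * norm (1 + u)"
      unfolding D_def by (rule order_trans[OF norm_triangle_ineq]) (use assms in \<open>simp add: norm_mult\<close>)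
    also have "\<dots> \<le> b * 2 + d * 2"
      using that norm_triangle_ineq4[of 1 u] norm_triangle_ineq[of 1 u] assms
      by (intro add_mono mult_left_mono) auto
    also have "\<dots> \<le> 2" using assms by simp
    finally show ?thesis .
  qed
  have hols: "s holomorphic_on ball 0 1"
    unfolding s_def D_def
    by (intro holomorphic_intros) (use D0 in \<open>auto simp: D_def\<close>)
  have conts: "continuous_on (cball 0 1) s"
    unfolding s_def D_def
    by (intro continuous_intros) (use D0 in \<open>auto simp: D_def\<close>)
  have holf: "f holomorphic_on ball 0 1"
    unfolding f_def
    by (intro holomorphic_intros holomorphic_on_compose_gen[OF hols hol, unfolded o_def]) auto
  have contf: "continuous_on (cball 0 1) f"
    unfolding f_def
    by (intro continuous_intros continuous_on_compose2[OF holomorphic_on_imp_continuous_on[OF hol] conts]) auto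
  have v: "Re (D u / (1 - u)) = b" if "norm u = 1" "u \<noteq> 1" for u
  proof -
    have "(Re u)\<^sup>2 + (Im u)\<^sup>2 = 1" using that by (simp add: cmod_def)
    then have "Re ((1 + u) / (1 - u)) = 0"
      by (simp add: Re_divide power2_eq_square algebra_simps)
    moreover have "D u / (1 - u) = of_real b + of_real d * ((1 + u) / (1 - u))"
      using that by (simp add: D_def add_divide_distrib distrib_left)
    moreover have "Re (of_real b + of_real d * z) = b + d * Re z" for z by simp
    ultimately show ?thesis by (simp only: mult_zero_right add_0_right)
  qed
  have s_v: "s u = 1 / (D u / (1 - u))" for u by (simp add: s_def)
  have f_bound: "norm (f u) \<le> 4 * K" if "norm u = 1" for u
  proof (cases "u = 1")
    case True then show ?thesis using \<open>K \<ge> 0\<close> by (simp add: f_def)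
  next
    case False
    have "norm (f u) = (norm (1 - u))\<^sup>2 * norm (g (1 / (D u / (1 - u))))"
      by (simp add: f_def s_v norm_mult norm_power)
    also have "\<dots> \<le> (norm (1 - u))\<^sup>2 * (K * (norm (D u / (1 - u)))\<^sup>2)"
      by (intro mult_left_mono bound v that False) auto
    also have "\<dots> = K * (norm (D u))\<^sup>2"
      using False by (simp add: norm_divide power_divide)
    also have "\<dots> \<le> K * 2\<^sup>2"
      using that D_le \<open>K \<ge> 0\<close> by (intro mult_left_mono power_mono) auto
    finally show ?thesis by simp
  qed
  have "8 / d > 0" using \<open>d > 0\<close> by simp
  then have "real M > 0" using M by linarith
  then have M1: "M \<ge> 1" by simp
  obtain \<theta> where \<theta>: "\<bar>\<theta>\<bar> \<le> pi / M" "norm (f 0) ^ M \<le> norm (f (cis \<theta>)) * (4 * K) ^ (M - 1)"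
    using exists_large_value_on_short_arc[OF holf contf f_bound M1] by auto
  have f0: "f 0 = g (1 / of_real (b + d))" by (simp add: f_def s_def D_def)
  define u where "u = cis \<theta>"
  have u1: "norm u = 1" by (simp add: u_def)
  have "u \<noteq> 1"
  proof
    assume "u = 1"
    then have "norm (f 0) ^ M \<le> 0" using \<theta>(2) by (simp add: f_def u_def)
    then show False using f0 nz by (simp add: power_le_zero_eq)
  qed
  define v where "v = D u / (1 - u)"
  have "norm (1 - u) \<le> \<bar>\<theta>\<bar>"
  proof -
    have "norm (1 - u) = 2 * \<bar>sin (\<theta> / 2)\<bar>"
      unfolding u_def by (metis norm_minus_commute cis_conv_exp dist_exp_i_1 )
    also have "\<dots> \<le> 2 * \<bar>\<theta> / 2\<bar>" by (intro mult_left_mono abs_sin_x_le_abs_x) auto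
    finally show ?thesis by simp
  qed
  then have d_u: "norm (1 - u) \<le> pi / M" using \<theta> by simp
  have pos: "norm (1 - u) > 0" using \<open>u \<noteq> 1\<close> by simp
  have "2 * d * M / pi = 2 * d / (pi / M)" by simp
  also have "\<dots> \<le> 2 * d / norm (1 - u)"
    using d_u pos \<open>d > 0\<close> \<open>real M > 0\<close> by (intro divide_left_mono mult_pos_pos) auto
  also have "\<dots> = norm (v - of_real (b - d))"
  proof -
    have "v - of_real (b - d) = of_real (2 * d) / (1 - u)"
      using \<open>u \<noteq> 1\<close> by (simp add: v_def D_def field_simps)
    then show ?thesis using \<open>d > 0\<close> by (simp add: norm_divide norm_mult)
  qed
  also have "\<dots> \<le> norm v + \<bar>b - d\<bar>"
    by (rule order_trans[OF norm_triangle_ineq4]) (metis order_refl norm_of_real)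
  finally have "2 * d * M / pi - 1 \<le> norm v" using assms by linarith
  \<comment> \<open>The gap between $2/3.2$ and $1/2$ pays for the summand 1, because \<open>d * M \<ge> 8\<close>.\<close>
  moreover have "2 * d * M / pi \<ge> 2 * d * M / 3.2"
    using \<open>d > 0\<close> pi_less_4 pi_approx by (intro divide_left_mono) auto
  moreover have "d * M \<ge> 8" using M \<open>d > 0\<close> by (simp add: field_simps)
  ultimately have nv: "norm v \<ge> d * M / 2" by simp
  have "norm (f u) \<le> 4 * norm (g (1 / v))"
  proof -
    have "norm (1 - u) \<le> 2" using norm_triangle_ineq4[of 1 u] u1 by simp
    then have "norm (1 - u) ^ 2 \<le> 2 ^ 2" by (intro power_mono) auto
    then show ?thesis
      by (auto simp: f_def s_v v_def norm_mult norm_power intro: mult_right_mono)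
  qed
  then have "norm (f u) * (4 * K) ^ (M - 1) \<le> 4 * norm (g (1 / v)) * (4 * K) ^ (M - 1)"
    using \<open>K \<ge> 0\<close> by (intro mult_right_mono) auto
  then have "norm (f 0) ^ M \<le> 4 * norm (g (1 / v)) * (4 * K) ^ (M - 1)"
    using \<theta>(2) unfolding u_def by linarith
  moreover have "Re v = b" unfolding v_def by (rule v[OF u1 \<open>u \<noteq> 1\<close>])
  ultimately show ?thesis using nv unfolding f0 by blast
qed

section \<open>From a half plane of decay to a large coefficient\<close>

lemma norm_one_minus_inverse_sq:
  fixes v :: complex
  assumes "v \<noteq> 0"
  shows "(norm (1 - of_real r / v))\<^sup>2 = 1 - r * (2 * Re v - r) / (norm v)\<^sup>2"
proof -
  have "norm (1 - of_real r / v) = norm (v - of_real r) / norm v"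
    using assms by (simp flip: norm_divide add: diff_divide_distrib)
  moreover have "(norm (v - of_real r))\<^sup>2 = (norm v)\<^sup>2 - r * (2 * Re v - r)"
    unfolding cmod_power2 by (simp add: power2_eq_square algebra_simps)
  moreover have "norm v > 0" using assms by simp
  ultimately show ?thesis by (simp add: power_divide diff_divide_distrib)
qed

text \<open>
  Only products of two neighbouring factors need to be small: this is what makes alternating
  retention probabilities accessible, where single factors may exceed 1 in modulus. The partial
  products then decay geometrically at half speed.
\<close>
lemma norm_sum_prods_le:
  fixes z :: "nat \<Rightarrow> complex" and A r :: real
  assumes "0 \<le> r" "r < 1" "A \<ge> 1"
    and zA: "\<And>l. norm (z l) \<le> A" and pair: "\<And>l. l \<ge> k0 \<Longrightarrow> norm (z l * z (Suc l)) \<le> r"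
    and c: "\<And>k. norm (c k) \<le> 1"
  shows "norm (\<Sum>k=k0..<n. c k * (\<Prod>l=k0..<k. z l)) \<le> 2 * A / (1 - r)"
proof -
  have even: "norm (\<Prod>l=k0..<k0 + 2 * i. z l) \<le> r ^ i" for i
  proof (induction i)
    case (Suc i)
    have "(\<Prod>l=k0..<k0 + 2 * Suc i. z l) = (\<Prod>l=k0..<k0 + 2 * i. z l) * (z (k0 + 2 * i) * z (Suc (k0 + 2 * i)))"
      by (simp add: mult.assoc)
    then have "norm (\<Prod>l=k0..<k0 + 2 * Suc i. z l) =
        norm (\<Prod>l=k0..<k0 + 2 * i. z l) * norm (z (k0 + 2 * i) * z (Suc (k0 + 2 * i)))"
      by (simp only: norm_mult)
    also have "\<dots> \<le> r ^ i * r" using Suc pair by (intro mult_mono) (auto simp: \<open>0 \<le> r\<close>)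
    finally show ?case by (simp add: mult.commute)
  qed simp
  have odd: "norm (\<Prod>l=k0..<k0 + Suc (2 * i). z l) \<le> A * r ^ i" for i
  proof -
    have "norm (\<Prod>l=k0..<k0 + Suc (2 * i). z l) = norm (\<Prod>l=k0..<k0 + 2 * i. z l) * norm (z (k0 + 2 * i))"
      by (simp add: norm_mult)
    also have "\<dots> \<le> r ^ i * A" using even zA by (intro mult_mono) (auto simp: \<open>0 \<le> r\<close>)
    finally show ?thesis by (simp add: mult.commute)
  qed
  have single: "norm (\<Prod>l=k0..<k0 + i. z l) \<le> A * r ^ (i div 2)" for i
  proof (cases "even i")
    case True
    then have "norm (\<Prod>l=k0..<k0 + i. z l) \<le> 1 * r ^ (i div 2)" using even[of "i div 2"] by simp
    also have "\<dots> \<le> A * r ^ (i div 2)" using assms by (intro mult_right_mono) auto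
    finally show ?thesis .
  next
    case False
    then show ?thesis using odd[of "i div 2"] by (simp add: odd_two_times_div_two_succ del: add_Suc_right)
  qed
  have geo: "(\<Sum>i<N. r ^ (i div 2)) \<le> 2 / (1 - r)" for N
  proof -
    have "(\<Sum>i<N. r ^ (i div 2)) \<le> (\<Sum>i<2 * N. r ^ (i div 2))"
      using \<open>0 \<le> r\<close> by (intro sum_mono2) auto
    also have "\<dots> = 2 * (\<Sum>i<N. r ^ i)"
      by (induction N) auto
    also have "(\<Sum>i<N. r ^ i) = (1 - r ^ N) / (1 - r)"
      using \<open>r < 1\<close> by (simp add: sum_gp_strict)
    also have "2 * \<dots> \<le> 2 * (1 / (1 - r))"
      using assms by (intro mult_left_mono divide_right_mono) auto
    finally show ?thesis by simp
  qed
  have "norm (\<Sum>k=k0..<n. c k * (\<Prod>l=k0..<k. z l)) \<le> (\<Sum>k=k0..<n. A * r ^ ((k - k0) div 2))"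
  proof (rule sum_norm_le)
    fix k assume "k \<in> {k0..<n}"
    then have "norm (c k) * norm (\<Prod>l=k0..<k. z l) \<le> 1 * (A * r ^ ((k - k0) div 2))"
      using single[of "k - k0"] c[of k] by (intro mult_mono) auto
    then show "norm (c k * (\<Prod>l=k0..<k. z l)) \<le> A * r ^ ((k - k0) div 2)"
      by (simp add: norm_mult)
  qed
  also have "\<dots> = A * (\<Sum>i<n - k0. r ^ (i div 2))"
  proof -
    have "(\<Sum>k=k0..<n. A * r ^ ((k - k0) div 2)) = (\<Sum>i<n - k0. A * r ^ (i div 2))"
      by (rule sum.reindex_bij_witness[of _ "\<lambda>i. i + k0" "\<lambda>k. k - k0"]) auto
    then show ?thesis by (simp add: sum_distrib_left)
  qed
  also have "\<dots> \<le> A * (2 / (1 - r))"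
    using geo \<open>A \<ge> 1\<close> by (intro mult_left_mono) auto
  finally show ?thesis by (simp add: mult.commute)
qed

lemma exp_neg_le_one_minus:
  fixes y :: real
  assumes "0 \<le> y" "y \<le> 1 / 2"
  shows "exp (- 2 * y) \<le> 1 - y"
proof -
  have "0 \<le> y * (1 - 2 * y)" using assms by (intro mult_nonneg_nonneg) auto
  then have "1 \<le> (1 - y) * (1 + 2 * y)" by (simp add: algebra_simps)
  also have "\<dots> \<le> (1 - y) * exp (2 * y)"
    using assms exp_ge_add_one_self[of "2 * y"] by (intro mult_left_mono) auto
  finally show ?thesis by (simp add: exp_minus field_simps)
qed

text \<open>
  With $s = 1 - w$ the factors of the generating function of a trace are
  $q_l + p_l w = 1 - p_l s$. If \<open>a\<close> is supported on \<open>k \<ge> k0\<close>, then \<open>tail_sum\<close> is the generating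
  function with weights \<open>a\<close>, divided by the factors with \<open>l < k0\<close>, which all its terms share.
  Its argument is below always written as $s = 1/v$.
\<close>
definition tail_sum :: "(nat \<Rightarrow> real) \<Rightarrow> (nat \<Rightarrow> real) \<Rightarrow> nat \<Rightarrow> nat \<Rightarrow> complex \<Rightarrow> complex" where
  "tail_sum a p k0 n s = (\<Sum>k=k0..<n. of_real (a k * p k) * (\<Prod>l=k0..<k. 1 - of_real (p l) * s))"

text \<open>
  The coefficients \<open>D\<close> of the generating function cannot all be tiny. A point \<open>b + d\<close> where the tail
  is not small, together with geometric decay on the line $\mathrm{Re}\,v = b$, yields a point
  \<open>v\<close> on that line at distance of order $n^{1/3}$ where the tail is at least $\exp(-Cn^{1/3})$.
  There the remaining quantities are harmless: $1 - p_l/v$ and $w = 1 - 1/v$ have modulus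
  $1 + O(|v|^{-2})$, and $n\,|v|^{-2} = O(n^{1/3})$, so neither the factors with \<open>l < k0\<close> nor the
  powers $w^j$ change the order of magnitude. The exponent $1/3$ balances this $n\,|v|^{-2}$
  against the loss $\exp(-c|v|)$ in finding a large value at distance $|v|$.
\<close>
lemma exists_large_coefficient:
  fixes b0 d c \<eta> :: real
  assumes "b0 > 0" "d > 0" "c > 0" "\<eta> > 0"
  obtains C where "C > 0"
    and "\<And>n p a D k0 b. \<lbrakk>n \<ge> 1; \<forall>k. 0 < p k \<and> p k \<le> 1; \<forall>k. \<bar>a k\<bar> \<le> 1; \<forall>k<k0. a k = 0; k0 < n;
        b0 \<le> b; b + d \<le> 1; norm (tail_sum a p k0 n (1 / of_real (b + d))) \<ge> \<eta>;
        \<forall>v l. Re v = b \<longrightarrow> l \<ge> k0 \<longrightarrow>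
          norm ((1 - of_real (p l) / v) * (1 - of_real (p (Suc l)) / v)) \<le> 1 - c / (norm v)\<^sup>2;
        \<forall>w::complex. (\<Sum>j<n. of_real (D j) * w ^ j) =
          (\<Sum>k<n. of_real (a k * p k) * (\<Prod>l<k. of_real (1 - p l) + of_real (p l) * w))\<rbrakk>
      \<Longrightarrow> \<exists>j<n. \<bar>D j\<bar> \<ge> exp (- C * real n powr (1/3))"
proof -
  \<comment> \<open>Added 1 makes \<open>K \<ge> 1\<close>, so that an exponent \<open>M - 1\<close> may be raised to \<open>M\<close>. In \<open>C\<close>, the 7 collects
    \<open>N\<close> for the factors before \<open>k0\<close>, \<open>N\<close> for $w^j$, \<open>3 * N\<close> for the number $n = N^3$ of
    coefficients, and \<open>2 * N\<close> for the constant 4; here $N = n^{1/3}$.\<close>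
  define K where "K = 2 * (1 + 1 / b0) / c + 1"
  have "K \<ge> 1" unfolding K_def using assms by simp
  define \<Lambda> where "\<Lambda> = \<bar>ln (\<eta> / (4 * K))\<bar>"
  define C where "C = 7 + \<Lambda> * (8 / d + 1)"
  have "\<Lambda> \<ge> 0" by (simp add: \<Lambda>_def)
  then have "C > 0" unfolding C_def using assms by (intro add_pos_nonneg) auto
  have coeff: "\<exists>j<n. \<bar>D j\<bar> \<ge> exp (- C * real n powr (1/3))"
    if n: "n \<ge> 1" and p_all: "\<forall>k. 0 < p k \<and> p k \<le> 1" and a_all: "\<forall>k. \<bar>a k\<bar> \<le> 1"
      and a0: "\<forall>k<k0. a k = 0" and k0: "k0 < n" and b: "b0 \<le> b" "b + d \<le> 1"
      and large: "norm (tail_sum a p k0 n (1 / of_real (b + d))) \<ge> \<eta>"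
      and pair_all: "\<forall>v l. Re v = b \<longrightarrow> l \<ge> k0 \<longrightarrow>
         norm ((1 - of_real (p l) / v) * (1 - of_real (p (Suc l)) / v)) \<le> 1 - c / (norm v)\<^sup>2"
      and gf: "\<forall>w::complex. (\<Sum>j<n. of_real (D j) * w ^ j) =
        (\<Sum>k<n. of_real (a k * p k) * (\<Prod>l<k. of_real (1 - p l) + of_real (p l) * w))"
    for n p a D k0 b
  proof (rule ccontr)
    note p = p_all[rule_format] and a = a_all[rule_format] and pair = pair_all[rule_format]
    define N where "N = real n powr (1/3)"
    have N3: "N ^ 3 = n" using n by (simp add: N_def powr_power)
    have N1: "N \<ge> 1" unfolding N_def using n by (intro ge_one_powr_ge_zero) auto
    assume "\<not> (\<exists>j<n. \<bar>D j\<bar> \<ge> exp (- C * real n powr (1/3)))"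
    then have small: "\<bar>D j\<bar> < exp (- C * N)" if "j < n" for j
      using that by (auto simp: N_def not_le)
    have "b > 0" using b assms by linarith
    define M where "M = nat \<lceil>8 / d * N\<rceil>"
    have M: "M \<ge> 8 / d * N" "M \<le> (8 / d + 1) * N"
    proof -
      have *: "0 \<le> 8 / d * N" using assms N1 by simp
      then have "real M = of_int \<lceil>8 / d * N\<rceil>" by (simp add: M_def)
      moreover have "8 / d * N \<le> of_int \<lceil>8 / d * N\<rceil>" "of_int \<lceil>8 / d * N\<rceil> \<le> 8 / d * N + 1"
        by linarith+
      moreover have "(8 / d + 1) * N = 8 / d * N + N" by (simp add: distrib_right)
      ultimately show "M \<ge> 8 / d * N" "M \<le> (8 / d + 1) * N"
        using N1 by linarith+
    qed
    have M8: "M \<ge> 8 / d"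
      using M(1) mult_left_mono[OF N1, of "8 / d"] assms by simp
    have vb: "v \<noteq> 0 \<and> norm v \<ge> b" if "Re v = b" for v
      using that \<open>b > 0\<close> complex_Re_le_cmod[of v] by auto
    have bound: "norm (tail_sum a p k0 n (1 / v)) \<le> K * (norm v)\<^sup>2" if "Re v = b" for v
    proof -
      let ?z = "\<lambda>l. 1 - of_real (p l) / v"
      have "norm v > 0" using vb[OF that] by auto
      define r where "r = 1 - c / (norm v)\<^sup>2"
      have "r < 1" unfolding r_def using assms \<open>norm v > 0\<close> by simp
      have "0 \<le> r" using pair[OF that order_refl] norm_ge_zero order_trans unfolding r_def by blast
      have zA: "norm (?z l) \<le> 1 + 1 / b0" for l
      proof -
        have "norm (?z l) \<le> 1 + p l / norm v"
          by (rule order_trans[OF norm_triangle_ineq4]) (use p[of l] in \<open>simp add: norm_divide\<close>)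
        also have "p l / norm v \<le> 1 / b0"
          using p[of l] vb[OF that] b assms by (intro frac_le) auto
        finally show ?thesis by simp
      qed
      have ap: "norm (of_real (a k * p k) :: complex) \<le> 1" for k
        using a[of k] p[of k] by (simp add: norm_mult mult_le_one)
      have "norm (tail_sum a p k0 n (1 / v)) \<le> 2 * (1 + 1 / b0) / (1 - r)"
        unfolding tail_sum_def
        using norm_sum_prods_le[OF \<open>0 \<le> r\<close> \<open>r < 1\<close> _ zA _ ap, where ?k0.0 = k0 and n = n] pair[OF that] assms
        by (simp add: r_def)
      also have "\<dots> = 2 * (1 + 1 / b0) / c * (norm v)\<^sup>2"
        unfolding r_def using assms \<open>norm v > 0\<close> by simp
      also have "\<dots> \<le> K * (norm v)\<^sup>2"
        unfolding K_def by (intro mult_right_mono) auto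
      finally show ?thesis .
    qed
    have hol: "tail_sum a p k0 n holomorphic_on UNIV"
      unfolding tail_sum_def[abs_def] by (intro holomorphic_intros)
    have nz: "tail_sum a p k0 n (1 / of_real (b + d)) \<noteq> 0"
      using large assms by auto
    have "K \<ge> 0" using \<open>K \<ge> 1\<close> by simp
    obtain v where v: "Re v = b" "norm v \<ge> d * M / 2"
      "norm (tail_sum a p k0 n (1 / of_real (b + d))) ^ M
         \<le> 4 * norm (tail_sum a p k0 n (1 / v)) * (4 * K) ^ (M - 1)"
      using exists_large_value_on_vertical_line[OF hol \<open>b > 0\<close> \<open>d > 0\<close> b(2) \<open>K \<ge> 0\<close> bound nz M8] by blast
    have "v \<noteq> 0" using vb v by auto
    have "d * M \<ge> 8 * N" using M(1) \<open>d > 0\<close> by (simp add: field_simps)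
    then have v4: "norm v \<ge> 4 * N" using v(2) by simp
    have n_v: "n / (norm v)\<^sup>2 \<le> N"
    proof -
      have "N\<^sup>2 \<le> (norm v)\<^sup>2" using v4 N1 by (intro power_mono) auto
      then have "N * N\<^sup>2 \<le> N * (norm v)\<^sup>2" using N1 by (intro mult_left_mono) auto
      then have "n \<le> N * (norm v)\<^sup>2" using N3 by (simp add: power3_eq_cube power2_eq_square)
      then show ?thesis using \<open>v \<noteq> 0\<close> by (simp add: divide_le_eq)
    qed
    define y where "y = 1 / (norm v)\<^sup>2"
    have y: "0 \<le> y" "y \<le> 1 / 2" "n * y \<le> N"
    proof -
      have "4 \<le> norm v" using v4 N1 by linarith
      then have "4\<^sup>2 \<le> (norm v)\<^sup>2" by (intro power_mono) auto
      then show "y \<le> 1 / 2" unfolding y_def by (intro frac_le) auto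
    qed (use n_v in \<open>simp_all add: y_def\<close>)
    have small_tail: "exp (- \<Lambda> * M) \<le> 4 * norm (tail_sum a p k0 n (1 / v))"
    proof -
      have "\<eta> ^ M \<le> 4 * norm (tail_sum a p k0 n (1 / v)) * (4 * K) ^ (M - 1)"
        using order_trans[OF power_mono[OF large, of M] v(3)] assms by simp
      also have "\<dots> \<le> 4 * norm (tail_sum a p k0 n (1 / v)) * (4 * K) ^ M"
        using \<open>K \<ge> 1\<close> by (intro mult_left_mono power_increasing) auto
      finally have "(\<eta> / (4 * K)) ^ M \<le> 4 * norm (tail_sum a p k0 n (1 / v))"
        using \<open>K \<ge> 1\<close> by (simp add: power_divide divide_le_eq)
      moreover have "exp (- \<Lambda>) \<le> \<eta> / (4 * K)"
      proof -
        have "- \<Lambda> \<le> ln (\<eta> / (4 * K))" unfolding \<Lambda>_def by linarith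
        then show ?thesis using assms \<open>K \<ge> 1\<close> by (subst ln_ge_iff[symmetric]) auto
      qed
      then have "exp (- \<Lambda>) ^ M \<le> (\<eta> / (4 * K)) ^ M" by (intro power_mono) auto
      ultimately show ?thesis by (simp flip: exp_of_nat_mult add: mult.commute)
    qed
    define w where "w = 1 - 1 / v"
    have zw: "of_real (1 - p l) + of_real (p l) * w = 1 - of_real (p l) * (1 / v)" for l
      by (simp add: w_def algebra_simps)
    have factor: "(\<Sum>k<n. of_real (a k * p k) * (\<Prod>l<k. of_real (1 - p l) + of_real (p l) * w))
      = (\<Prod>l<k0. 1 - of_real (p l) / v) * tail_sum a p k0 n (1 / v)"
    proof -
      have "(\<Sum>k<n. of_real (a k * p k) * (\<Prod>l<k. of_real (1 - p l) + of_real (p l) * w))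
        = (\<Sum>k=k0..<n. of_real (a k * p k) * (\<Prod>l<k. 1 - of_real (p l) * (1 / v)))"
        unfolding zw by (rule sum.mono_neutral_right) (use a0 in auto)
      also have "\<dots> = (\<Sum>k=k0..<n. of_real (a k * p k) *
          ((\<Prod>l<k0. 1 - of_real (p l) * (1 / v)) * (\<Prod>l=k0..<k. 1 - of_real (p l) * (1 / v))))"
      proof (intro sum.cong refl)
        fix k assume "k \<in> {k0..<n}"
        then have "{..<k} = {..<k0} \<union> {k0..<k}" "{..<k0} \<inter> {k0..<k} = {}" by auto
        then show "of_real (a k * p k) * (\<Prod>l<k. 1 - of_real (p l) * (1 / v)) = of_real (a k * p k) *
          ((\<Prod>l<k0. 1 - of_real (p l) * (1 / v)) * (\<Prod>l=k0..<k. 1 - of_real (p l) * (1 / v)))"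
          by (simp add: prod.union_disjoint)
      qed
      also have "\<dots> = (\<Prod>l<k0. 1 - of_real (p l) / v) * tail_sum a p k0 n (1 / v)"
        by (simp add: tail_sum_def sum_distrib_left mult_ac)
      finally show ?thesis .
    qed
    have prefix: "exp (- N) \<le> norm (\<Prod>l<k0. 1 - of_real (p l) / v)"
    proof -
      have each: "exp (- y) \<le> norm (1 - of_real (p l) / v)" for l
      proof -
        have "p l * (2 * b - p l) \<le> 1"
        proof -
          have "b\<^sup>2 \<le> 1\<^sup>2" using b \<open>b > 0\<close> \<open>d > 0\<close> by (intro power_mono) auto
          then show ?thesis using zero_le_power2[of "p l - b"] by (simp add: power2_eq_square algebra_simps)
        qed
        then have "p l * (2 * b - p l) * y \<le> 1 * y" using y by (intro mult_right_mono)
        then have "(norm (1 - of_real (p l) / v))\<^sup>2 \<ge> 1 - y"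
          unfolding norm_one_minus_inverse_sq[OF \<open>v \<noteq> 0\<close>] y_def by (simp add: v)
        moreover have "(exp (- y))\<^sup>2 \<le> 1 - y"
          using exp_neg_le_one_minus[OF y(1,2)] by (simp flip: exp_of_nat_mult)
        ultimately have "(exp (- y))\<^sup>2 \<le> (norm (1 - of_real (p l) / v))\<^sup>2" by linarith
        then show ?thesis by (rule power2_le_imp_le) simp
      qed
      have "k0 * y \<le> n * y" using k0 y(1) by (intro mult_right_mono) auto
      then have "exp (- N) \<le> exp (k0 * (- y))" using y by simp
      also have "\<dots> = (\<Prod>l<k0. exp (- y))" by (simp only: exp_of_nat_mult prod_constant card_lessThan)
      also have "\<dots> \<le> (\<Prod>l<k0. norm (1 - of_real (p l) / v))"
        by (intro prod_mono) (use each in auto)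
      finally show ?thesis by (simp add: prod_norm)
    qed
    have w_pow: "norm w ^ j \<le> exp N" if "j < n" for j
    proof -
      have "(norm w)\<^sup>2 = 1 - (2 * b - 1) * y"
        using norm_one_minus_inverse_sq[OF \<open>v \<noteq> 0\<close>, of 1] by (simp add: w_def v y_def)
      also have "\<dots> \<le> 1 + y" using y \<open>b > 0\<close> by (simp add: algebra_simps)
      also have "\<dots> \<le> exp y" by (rule exp_ge_add_one_self)
      also have "\<dots> \<le> (exp y)\<^sup>2" using y by (simp flip: exp_of_nat_mult)
      finally have "norm w \<le> exp y" by (rule power2_le_imp_le) simp
      then have "norm w ^ j \<le> exp y ^ j" by (intro power_mono) auto
      also have "\<dots> = exp (j * y)" by (simp add: exp_of_nat_mult)
      also have "j * y \<le> n * y" using that y(1) by (intro mult_right_mono) auto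
      finally show ?thesis using y by (auto intro: order_trans)
    qed
    have upper: "norm (\<Sum>j<n. of_real (D j) * w ^ j) < n * (exp (- C * N) * exp N)"
    proof -
      have "norm (\<Sum>j<n. of_real (D j) * w ^ j) \<le> (\<Sum>j<n. \<bar>D j\<bar> * exp N)"
        by (rule sum_norm_le) (use w_pow in \<open>auto simp: norm_mult norm_power intro!: mult_left_mono\<close>)
      also have "\<dots> < (\<Sum>j<n. exp (- C * N) * exp N)"
        by (rule sum_strict_mono) (use small n in \<open>auto simp: lessThan_empty_iff\<close>)
      finally show ?thesis by simp
    qed
    have "n \<le> exp (3 * N)" unfolding N_def by (rule le_exp_cube_root)
    then have "n * (exp (- C * N) * exp N) \<le> exp (3 * N) * (exp (- C * N) * exp N)"
      by (intro mult_right_mono) auto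
    also have "\<dots> = exp ((4 - C) * N)" by (simp add: algebra_simps flip: exp_add)
    finally have up: "norm (\<Sum>j<n. of_real (D j) * w ^ j) < exp ((4 - C) * N)"
      using upper by linarith
    have "exp (- N) * exp (- \<Lambda> * M) \<le> norm (\<Prod>l<k0. 1 - of_real (p l) / v) * (4 * norm (tail_sum a p k0 n (1 / v)))"
      by (intro mult_mono prefix small_tail) auto
    also have "\<dots> = 4 * norm (\<Sum>j<n. of_real (D j) * w ^ j)"
      unfolding gf[rule_format] factor by (simp add: norm_mult)
    also have "\<dots> < exp (2 * N) * exp ((4 - C) * N)"
    proof -
      have "(4::real) \<le> (1 + 1)\<^sup>2" by simp
      also have "\<dots> \<le> (exp 1)\<^sup>2" using exp_ge_add_one_self[of 1] by (intro power_mono) auto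
      also have "\<dots> = exp 2" by (simp flip: exp_of_nat_mult)
      also have "\<dots> \<le> exp (2 * N)" using N1 by simp
      finally show ?thesis using up by (intro mult_le_less_imp_less) auto
    qed
    finally have "exp (- N + - \<Lambda> * M) < exp (2 * N + (4 - C) * N)" by (simp only: exp_add)
    then have "- N - \<Lambda> * M < 2 * N + (4 - C) * N" by simp
    moreover have "\<Lambda> * M \<le> \<Lambda> * ((8 / d + 1) * N)" using M \<open>\<Lambda> \<ge> 0\<close> by (intro mult_left_mono)
    ultimately show False unfolding C_def by (simp add: algebra_simps)
  qed
  show thesis by (rule that[OF \<open>C > 0\<close>]) (rule coeff)
qed

text \<open>
  What the analysis asks of the retention probabilities when \<open>k0\<close> is the first position at which
  two strings differ: \<open>a\<close> stands for the difference of the indicators of the letter that one of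
  them has there. The lower bound \<open>b0\<close> and the numbers \<open>d\<close>, \<open>c\<close>, \<open>\<eta>\<close> are the constants that must
  not depend on \<open>n\<close>, whereas the line $\mathrm{Re}\,v = b$ may vary with \<open>k0\<close>.
\<close>
definition favourable :: "real \<Rightarrow> real \<Rightarrow> real \<Rightarrow> real \<Rightarrow> (nat \<Rightarrow> real) \<Rightarrow> nat \<Rightarrow> nat \<Rightarrow> bool" where
  "favourable b0 d c \<eta> p n k0 \<longleftrightarrow> (\<forall>a. (\<forall>k. a k \<in> {-1, 0, 1}) \<and> a k0 = 1 \<longrightarrow>
     (\<exists>b\<ge>b0. b + d \<le> 1 \<and> norm (tail_sum a p k0 n (1 / of_real (b + d))) \<ge> \<eta> \<and>
       (\<forall>v l. Re v = b \<longrightarrow> l \<ge> k0 \<longrightarrow>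
         norm ((1 - of_real (p l) / v) * (1 - of_real (p (Suc l)) / v)) \<le> 1 - c / (norm v)\<^sup>2)))"

lemma separated_if_favourable:
  assumes "b0 > 0" "d > 0" "c > 0" "\<eta> > 0"
  obtains C where "C > 0"
    and "\<And>n p k0 x y. \<lbrakk>n \<ge> 1; \<forall>k. 0 < p k \<and> p k \<le> 1; favourable b0 d c \<eta> p n k0;
        x \<in> words m n; y \<in> words m n; k0 < n; \<forall>k<k0. x ! k = y ! k; x ! k0 \<noteq> y ! k0\<rbrakk>
      \<Longrightarrow> separated (exp (- C * real n powr (1/3))) m n p x y"
proof -
  obtain C where C: "C > 0" and coeff:
    "\<And>n p a D k0 b. \<lbrakk>n \<ge> 1; \<forall>k. 0 < p k \<and> p k \<le> 1; \<forall>k. \<bar>a k\<bar> \<le> 1; \<forall>k<k0. a k = 0; k0 < n; b0 \<le> b; b + d \<le> 1;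
     norm (tail_sum a p k0 n (1 / of_real (b + d))) \<ge> \<eta>;
     \<forall>v l. Re v = b \<longrightarrow> l \<ge> k0 \<longrightarrow>
         norm ((1 - of_real (p l) / v) * (1 - of_real (p (Suc l)) / v)) \<le> 1 - c / (norm v)\<^sup>2;
     \<forall>w::complex. (\<Sum>j<n. of_real (D j) * w ^ j) =
        (\<Sum>k<n. of_real (a k * p k) * (\<Prod>l<k. of_real (1 - p l) + of_real (p l) * w))\<rbrakk> \<Longrightarrow>
     \<exists>j<n. \<bar>D j\<bar> \<ge> exp (- C * real n powr (1/3))"
    by (rule exists_large_coefficient[OF assms]) (erule that)
  have sep: "separated (exp (- C * real n powr (1/3))) m n p x y"
    if n: "n \<ge> 1" and p: "\<forall>k. 0 < p k \<and> p k \<le> 1" and fav: "favourable b0 d c \<eta> p n k0"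
      and x: "x \<in> words m n" and y: "y \<in> words m n" and k0: "k0 < n"
      and eq: "\<forall>k<k0. x ! k = y ! k" and neq: "x ! k0 \<noteq> y ! k0" for n p k0 x y
  proof -
    \<comment> \<open>The letter \<open>x ! k0\<close> makes \<open>a k0 = 1\<close>; for another letter \<open>a k0\<close> might vanish.\<close>
    define e where "e = x ! k0"
    have len: "length x = n" "length y = n" using x y by (auto simp: words_def)
    have "e < m" using x k0 unfolding e_def words_def by (auto simp: in_lists_conv_set)
    define a :: "nat \<Rightarrow> real" where "a k = of_bool (x ! k = e) - of_bool (y ! k = e)" for k
    define Pr where "Pr z j = measure_pmf.prob (deletion_channel p z) {t. j < length t \<and> t ! j = e}" for z j
    have a_vals: "a k \<in> {-1, 0, 1}" for k by (simp add: a_def)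
    have a_k0: "a k0 = 1" using neq by (simp add: a_def e_def)
    have a_pre: "\<forall>k<k0. a k = 0" using eq by (simp add: a_def)
    obtain b where b: "b0 \<le> b" "b + d \<le> 1"
        "norm (tail_sum a p k0 n (1 / of_real (b + d))) \<ge> \<eta>"
        "\<forall>v l. Re v = b \<longrightarrow> l \<ge> k0 \<longrightarrow>
         norm ((1 - of_real (p l) / v) * (1 - of_real (p (Suc l)) / v)) \<le> 1 - c / (norm v)\<^sup>2"
      using fav a_vals a_k0 unfolding favourable_def by blast
    have p01: "0 \<le> p k \<and> p k \<le> 1" for k using p by (simp add: less_imp_le)
    have gf: "(\<Sum>j<n. of_real (Pr x j - Pr y j) * w ^ j) =
        (\<Sum>k<n. of_real (a k * p k) * (\<Prod>l<k. of_real (1 - p l) + of_real (p l) * w))" for w :: complex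
    proof -
      have "(\<Sum>j<n. of_real (Pr x j - Pr y j) * w ^ j) =
          (\<Sum>j<length x. of_real (Pr x j) * w ^ j) - (\<Sum>j<length y. of_real (Pr y j) * w ^ j)"
        by (simp add: len left_diff_distrib sum_subtractf)
      also have "\<dots> = (\<Sum>k<n. of_real (a k * p k) * (\<Prod>l<k. of_real (1 - p l) + of_real (p l) * w))"
        unfolding Pr_def generating_function_trace[OF p01]
        unfolding len sum_subtractf[symmetric] left_diff_distrib[symmetric]
        by (intro sum.cong refl) (simp add: a_def split: split_of_bool)
      finally show ?thesis .
    qed
    have "\<forall>k. \<bar>a k\<bar> \<le> 1" using a_vals by (simp add: a_def)
    moreover have "\<forall>w::complex. (\<Sum>j<n. of_real (Pr x j - Pr y j) * w ^ j) =
        (\<Sum>k<n. of_real (a k * p k) * (\<Prod>l<k. of_real (1 - p l) + of_real (p l) * w))"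
      using gf by blast
    ultimately obtain j where "j < n" "\<bar>Pr x j - Pr y j\<bar> \<ge> exp (- C * real n powr (1/3))"
      using coeff[OF n p _ a_pre k0 b, where D = "\<lambda>j. Pr x j - Pr y j"] by blast
    then show ?thesis using \<open>e < m\<close> unfolding separated_def Pr_def by blast
  qed
  show thesis by (rule that[OF C]) (rule sep)
qed

section \<open>Half planes of decay for the two families of channels\<close>

text \<open>
  At $v = p_{k_0}$ the factor with index \<open>k0\<close> vanishes, which leaves only the first term.
\<close>
lemma tail_sum_at_first_root:
  assumes "k0 < n" "p k0 > 0"
  shows "tail_sum a p k0 n (1 / of_real (p k0)) = of_real (a k0 * p k0)"
proof -
  have "(\<Prod>l=k0..<k. 1 - of_real (p l) * (1 / complex_of_real (p k0))) = of_bool (k = k0)" if "k \<ge> k0" for k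
    using that assms(2) by (cases "k = k0") (auto intro!: prod_zero bexI[of _ k0])
  then have "tail_sum a p k0 n (1 / of_real (p k0)) = (\<Sum>k=k0..<n. of_real (a k * p k) * of_bool (k = k0))"
    unfolding tail_sum_def by (intro sum.cong) auto
  also have "\<dots> = (\<Sum>k\<in>{k0}. of_real (a k * p k) * of_bool (k = k0))"
    by (rule sum.mono_neutral_right) (use assms in auto)
  finally show ?thesis by simp
qed

text \<open>
  At $v = p_{k_0+1}$ the factor with index \<open>Suc k0\<close> vanishes, which leaves the first two terms.
\<close>
lemma tail_sum_at_second_root:
  assumes "Suc k0 < n" "p (Suc k0) > 0"
  shows "tail_sum a p k0 n (1 / of_real (p (Suc k0))) =
    of_real (a k0 * p k0 + a (Suc k0) * (p (Suc k0) - p k0))"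
proof -
  let ?s = "1 / complex_of_real (p (Suc k0))"
  have "tail_sum a p k0 n ?s =
      of_real (a k0 * p k0) + (\<Sum>k=Suc k0..<n. of_real (a k * p k) * (\<Prod>l=k0..<k. 1 - of_real (p l) * ?s))"
    unfolding tail_sum_def using assms by (subst sum.atLeast_Suc_lessThan) auto
  also have "(\<Sum>k=Suc k0..<n. of_real (a k * p k) * (\<Prod>l=k0..<k. 1 - of_real (p l) * ?s)) =
      (1 - of_real (p k0) * ?s) * tail_sum a p (Suc k0) n ?s"
    unfolding tail_sum_def sum_distrib_left
    by (intro sum.cong refl) (simp add: prod.atLeast_Suc_lessThan)
  also have "tail_sum a p (Suc k0) n ?s = of_real (a (Suc k0) * p (Suc k0))"
    by (rule tail_sum_at_first_root) (use assms in auto)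
  finally show ?thesis using assms by (simp add: distrib_left left_diff_distrib right_diff_distrib mult.commute)
qed

text \<open>
  On a line $\mathrm{Re}\,v = b$ a factor $1 - p_l/v$ has modulus below 1 exactly if $b > p_l/2$.
  The point $v = p_{k_0}$, where the tail is as large as its first term, is therefore separated by
  a suitable line from all the later $p_l/2$ precisely because $p_{k_0} > p_l/2 + \delta$; the line
  at distance $\delta/2$ to the left of it leaves a margin on both sides.
\<close>
lemma favourable_if_dominating:
  assumes "0 < \<delta>" "\<And>k. 0 < p k \<and> p k \<le> 1" and half: "\<And>k l. k > l \<Longrightarrow> p l > p k / 2 + \<delta>"
    and low: "\<And>k. k > 0 \<Longrightarrow> p k > \<delta>" and "k0 < n"
  shows "favourable (\<delta> / 2) (\<delta> / 2) (\<delta>\<^sup>2 / 2) \<delta> p n k0"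
proof -
  have lower: "p k > \<delta>" for k
    using low[of k] half[of 0 1] assms(2)[of 1] by (cases "k = 0") auto
  define b where "b = p k0 - \<delta> / 2"
  have b: "b \<ge> \<delta> / 2" "b + \<delta> / 2 = p k0" using lower[of k0] by (simp_all add: b_def)
  have pair: "norm ((1 - of_real (p l) / v) * (1 - of_real (p (Suc l)) / v)) \<le> 1 - (\<delta>\<^sup>2 / 2) / (norm v)\<^sup>2"
    if "Re v = b" "l \<ge> k0" for v :: complex and l
  proof -
    have "v \<noteq> 0" using that b \<open>0 < \<delta>\<close> by auto
    have sq: "(norm (1 - of_real (p i) / v))\<^sup>2 \<le> 1 - (\<delta>\<^sup>2 / 2) / (norm v)\<^sup>2" if "i \<ge> k0" for i
    proof -
      have "2 * b - p i \<ge> \<delta> / 2"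
      proof (cases "i = k0")
        case True
        then show ?thesis using half[of k0 "Suc k0"] lower[of "Suc k0"] by (simp add: b_def)
      next
        case False
        then show ?thesis using half[of k0 i] \<open>i \<ge> k0\<close> \<open>0 < \<delta>\<close> by (simp add: b_def)
      qed
      then have "\<delta> * (\<delta> / 2) \<le> p i * (2 * b - p i)"
        using lower[of i] \<open>0 < \<delta>\<close> by (intro mult_mono) auto
      then show ?thesis
        unfolding norm_one_minus_inverse_sq[OF \<open>v \<noteq> 0\<close>] \<open>Re v = b\<close>
        by (intro diff_left_mono divide_right_mono) (auto simp: power2_eq_square)
    qed
    let ?r = "1 - (\<delta>\<^sup>2 / 2) / (norm v)\<^sup>2"
    have "0 \<le> ?r" using sq[OF order_refl] zero_le_power2 order_trans by blast
    have "(norm (1 - of_real (p l) / v) * norm (1 - of_real (p (Suc l)) / v))\<^sup>2 \<le> ?r * ?r"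
      unfolding power_mult_distrib using sq[of l] sq[of "Suc l"] \<open>l \<ge> k0\<close> \<open>0 \<le> ?r\<close>
      by (intro mult_mono) auto
    then have "(norm (1 - of_real (p l) / v) * norm (1 - of_real (p (Suc l)) / v))\<^sup>2 \<le> ?r\<^sup>2"
      by (simp only: power2_eq_square)
    then show ?thesis
      unfolding norm_mult using \<open>0 \<le> ?r\<close> by (rule power2_le_imp_le)
  qed
  show ?thesis
    unfolding favourable_def
  proof (intro allI impI, elim conjE, intro exI[of _ b] conjI)
    fix a :: "nat \<Rightarrow> real" assume "a k0 = 1"
    then show "norm (tail_sum a p k0 n (1 / of_real (b + \<delta> / 2))) \<ge> \<delta>"
      unfolding b(2) using tail_sum_at_first_root[OF \<open>k0 < n\<close>] assms(2)[of k0] lower[of k0] by simp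
  qed (use b assms(2)[of k0] pair in auto)
qed

text \<open>
  With $X = |v|^2$ the square of the modulus is $(1 - P/X)(1 - Q/X)$ for the \<open>P\<close>, \<open>Q\<close> below, and
  \<open>gap\<close> says that $P + Q > 0$. The quadratic term is controlled by $X \ge b^2 \ge P, Q$.
\<close>
lemma norm_two_factors_le:
  fixes b r s :: real
  assumes "b > 0" and gap: "r\<^sup>2 + s\<^sup>2 < 2 * b * (r + s)"
  shows "\<exists>c>0. \<forall>v. Re v = b \<longrightarrow> norm ((1 - of_real r / v) * (1 - of_real s / v)) \<le> 1 - c / (norm v)\<^sup>2"
proof -
  define P Q where "P = r * (2 * b - r)" and "Q = s * (2 * b - s)"
  have PQ: "P + Q > 0" using gap by (simp add: P_def Q_def power2_eq_square algebra_simps)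
  have Pb: "P \<le> b\<^sup>2" using zero_le_power2[of "b - r"] by (simp add: P_def power2_eq_square algebra_simps)
  have Qb: "Q \<le> b\<^sup>2" using zero_le_power2[of "b - s"] by (simp add: Q_def power2_eq_square algebra_simps)
  define c where "c = P + Q - max 0 (P * Q) / b\<^sup>2"
  have "c > 0"
  proof (cases "P * Q \<le> 0")
    case True then show ?thesis using PQ by (simp add: c_def)
  next
    case False
    then have "P > 0" "Q > 0" using PQ by (auto simp: zero_less_mult_iff not_le)
    then have "P * Q \<le> P * b\<^sup>2" "0 < Q * b\<^sup>2"
      using Qb \<open>b > 0\<close> by (auto intro: mult_left_mono)
    then have "P * Q < (P + Q) * b\<^sup>2" unfolding distrib_right by linarith
    then show ?thesis using False \<open>b > 0\<close> by (simp add: c_def divide_less_eq)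
  qed
  have "norm ((1 - of_real r / v) * (1 - of_real s / v)) \<le> 1 - (c / 2) / (norm v)\<^sup>2" if v: "Re v = b" for v
  proof -
    have "v \<noteq> 0" using v \<open>b > 0\<close> by auto
    define X where "X = (norm v)\<^sup>2"
    have X: "X \<ge> b\<^sup>2" unfolding X_def using complex_Re_le_cmod[of v] v \<open>b > 0\<close> by (intro power_mono) auto
    have "X > 0" using \<open>v \<noteq> 0\<close> by (simp add: X_def)
    have "(norm ((1 - of_real r / v) * (1 - of_real s / v)))\<^sup>2 = (1 - P / X) * (1 - Q / X)"
      unfolding norm_mult power_mult_distrib norm_one_minus_inverse_sq[OF \<open>v \<noteq> 0\<close>] v X_def P_def Q_def ..
    also have "\<dots> = 1 - (P + Q) / X + (P * Q) / X / X"
      by (simp add: algebra_simps add_divide_distrib)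
    also have "\<dots> \<le> 1 - (P + Q) / X + max 0 (P * Q) / b\<^sup>2 / X"
    proof -
      have "P * Q / X \<le> max 0 (P * Q) / b\<^sup>2"
        using X \<open>X > 0\<close> \<open>b > 0\<close> by (intro frac_le) auto
      then show ?thesis using \<open>X > 0\<close> by (intro add_left_mono divide_right_mono) auto
    qed
    also have "\<dots> = 1 - c / X" by (simp add: c_def diff_divide_distrib)
    finally have sq: "(norm ((1 - of_real r / v) * (1 - of_real s / v)))\<^sup>2 \<le> 1 - c / X" .
    then have "0 \<le> 1 - c / X" using zero_le_power2 order_trans by blast
    then have "0 \<le> 1 - (c / 2) / X" using \<open>c > 0\<close> \<open>X > 0\<close> by (simp add: field_simps)
    moreover have "1 - c / X \<le> (1 - (c / 2) / X)\<^sup>2"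
      using zero_le_power2[of "(c / 2) / X"] by (simp add: power2_diff)
    ultimately show ?thesis using sq power2_le_imp_le unfolding X_def by (meson order_trans)
  qed
  then show ?thesis using \<open>c > 0\<close> by (intro exI[of _ "c / 2"]) auto
qed

text \<open>
  All products of neighbouring factors are equal, and they are small to the right of
  $\mu = (r^2 + s^2)/(2(r + s))$, which is always below $\max(r,s)$. If $s \le 2r$, then
  \<open>r > \<mu>\<close> too, and the tail at \<open>v = r\<close> is its first term. If $s > 2r$, then \<open>v = s\<close> is used, where
  the tail is $r$, $s$ or $2r - s$, none of which is 0. So $s = 2r$, where the second choice may
  fail, is covered by the first.
\<close>
lemma favourable_if_alternating:
  fixes r s :: real
  assumes r: "0 < r" "r \<le> 1" and s: "0 < s" "s \<le> 1"
  obtains b0 d c \<eta> where "b0 > 0" "d > 0" "c > 0" "\<eta> > 0"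
    and "\<And>p n k0. \<lbrakk>k0 < n; \<forall>l\<ge>k0. p l = (if even (l - k0) then r else s)\<rbrakk>
      \<Longrightarrow> favourable b0 d c \<eta> p n k0"
proof -
  define \<mu> where "\<mu> = (r\<^sup>2 + s\<^sup>2) / (2 * (r + s))"
  define v0 where "v0 = (if s \<le> 2 * r then r else s)"
  define \<eta> where "\<eta> = (if s \<le> 2 * r then r else min r (s - 2 * r))"
  have "\<mu> > 0" using assms by (simp add: \<mu>_def add_pos_pos)
  have "r\<^sup>2 + s\<^sup>2 < 2 * v0 * (r + s)"
  proof (cases "s \<le> 2 * r")
    case True
    then have "s * s \<le> 2 * r * s" using s by (intro mult_right_mono) auto
    moreover have "r * r > 0" using r by simp
    ultimately show ?thesis using True by (simp add: v0_def power2_eq_square algebra_simps)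
  next
    case False
    then have "r * r \<le> s * s" using r by (intro mult_mono) auto
    moreover have "r * s > 0" using r s by simp
    ultimately show ?thesis using False by (simp add: v0_def power2_eq_square algebra_simps)
  qed
  then have "\<mu> < v0" using r s by (simp add: \<mu>_def divide_less_eq mult_ac)
  \<comment> \<open>The line halfway between \<open>\<mu>\<close> and \<open>v0\<close>.\<close>
  define b where "b = (v0 + \<mu>) / 2"
  define d where "d = (v0 - \<mu>) / 2"
  have bd: "b > 0" "d > 0" "b + d = v0" "v0 \<le> 1" "\<mu> < b"
    using \<open>\<mu> > 0\<close> \<open>\<mu> < v0\<close> r s by (auto simp: b_def d_def v0_def field_simps)
  have "\<eta> > 0" using r by (simp add: \<eta>_def)
  have "r\<^sup>2 + s\<^sup>2 < 2 * b * (r + s)"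
    using bd(5) r s by (simp add: \<mu>_def divide_less_eq mult_ac)
  then obtain c where c: "c > 0"
    "\<And>v. Re v = b \<Longrightarrow> norm ((1 - of_real r / v) * (1 - of_real s / v)) \<le> 1 - c / (norm v)\<^sup>2"
    using norm_two_factors_le[OF \<open>b > 0\<close>] by blast
  have fav: "favourable b d c \<eta> p n k0"
    if k0: "k0 < n" and p: "\<forall>l\<ge>k0. p l = (if even (l - k0) then r else s)" for p n k0
    unfolding favourable_def
  proof (intro allI impI, elim conjE, intro exI[of _ b] conjI)
    fix a :: "nat \<Rightarrow> real" assume a: "\<forall>k. a k \<in> {-1, 0, 1}" "a k0 = 1"
    have p0: "p k0 = r" "p (Suc k0) = s" using p by auto
    show "norm (tail_sum a p k0 n (1 / of_real (b + d))) \<ge> \<eta>"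
    proof (cases "s \<le> 2 * r")
      case True
      then show ?thesis
        using tail_sum_at_first_root[OF k0, of p a] r a unfolding bd(3) by (simp add: v0_def \<eta>_def p0)
    next
      case False
      show ?thesis
      proof (cases "Suc k0 < n")
        case True
        have "tail_sum a p k0 n (1 / of_real (b + d)) = of_real (r + a (Suc k0) * (s - r))"
          using tail_sum_at_second_root[OF True, of p a] s False a unfolding bd(3) by (simp add: v0_def p0)
        moreover have "a (Suc k0) = -1 \<or> a (Suc k0) = 0 \<or> a (Suc k0) = 1" using a by auto
        then have "\<eta> \<le> \<bar>r + a (Suc k0) * (s - r)\<bar>"
          using False r by (auto simp: \<eta>_def)
        ultimately show ?thesis by (simp only: norm_of_real)
      next
        case last: False
        then have "{k0..<n} = {k0}" using k0 by auto
        then have "tail_sum a p k0 n (1 / of_real (b + d)) = of_real r"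
          by (simp add: tail_sum_def p0 a)
        then show ?thesis using False r by (simp add: \<eta>_def)
      qed
    qed
    show "\<forall>v l. Re v = b \<longrightarrow> l \<ge> k0 \<longrightarrow>
         norm ((1 - of_real (p l) / v) * (1 - of_real (p (Suc l)) / v)) \<le> 1 - c / (norm v)\<^sup>2"
    proof (intro allI impI)
      fix v l assume "Re v = b" "l \<ge> k0"
      then show "norm ((1 - of_real (p l) / v) * (1 - of_real (p (Suc l)) / v)) \<le> 1 - c / (norm v)\<^sup>2"
        using c(2)[of v] p by (auto simp: Suc_diff_le mult.commute)
    qed
  qed (use bd in auto)
  show thesis by (rule that[OF bd(1,2) c(1) \<open>\<eta> > 0\<close>]) (rule fav)
qed

section \<open>Reconstruction of strings\<close>

lemma first_difference:
  assumes "x \<in> words m n" "y \<in> words m n" "x \<noteq> y"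
  obtains k where "k < n" "\<And>l. l < k \<Longrightarrow> x ! l = y ! l" "x ! k \<noteq> y ! k"
proof -
  have len: "length x = n" "length y = n" using assms by (auto simp: words_def)
  then obtain k0 where "k0 < n \<and> x ! k0 \<noteq> y ! k0"
    using assms nth_equalityI by metis
  then have "\<exists>k. (k < n \<and> x ! k \<noteq> y ! k) \<and> (\<forall>l<k. \<not> (l < n \<and> x ! l \<noteq> y ! l))"
    using exists_least_iff[of "\<lambda>k. k < n \<and> x ! k \<noteq> y ! k"] by blast
  then show ?thesis using that by (meson less_trans)
qed

theorem theorem1p1:
  fixes \<epsilon> :: real and m :: nat
  assumes "\<epsilon> > 0" and "m \<ge> 2"
  shows "(\<forall>\<delta>::real. 0 < \<delta> \<and> \<delta> < 1 \<longrightarrow>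
            (\<exists>C::real. C > 0 \<and>
              (\<forall>p :: nat \<Rightarrow> real.
                 (\<forall>k. 0 < p k \<and> p k \<le> 1) \<and>
                 (\<forall>k l. k > l \<longrightarrow> p l > p k / 2 + \<delta>) \<and>
                 (\<forall>k>0. p k > \<delta>) \<longrightarrow>
                 (\<forall>n::nat. n \<ge> 1 \<longrightarrow>
                    reconstructible \<epsilon> m n p (nat \<lceil>exp (C * real n powr (1/3))\<rceil>)))))
       \<and>
         (\<forall>q q' :: real. 0 \<le> q \<and> q < 1 \<and> 0 \<le> q' \<and> q' < 1 \<longrightarrow>
            (\<exists>C::real. C > 0 \<and>
              (\<forall>n::nat. n \<ge> 1 \<longrightarrow>
                 reconstructible \<epsilon> m n (\<lambda>k. 1 - (if even k then q else q'))
                   (nat \<lceil>exp (C * real n powr (1/3))\<rceil>))))"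
proof (intro conjI allI impI)
  have "m \<ge> 1" using assms by simp
  fix \<delta> :: real assume \<delta>: "0 < \<delta> \<and> \<delta> < 1"
  have pos: "\<delta> / 2 > 0" "\<delta> / 2 > 0" "\<delta>\<^sup>2 / 2 > 0" "\<delta> > 0" using \<delta> by auto
  obtain C where C: "C > 0" and sep: "\<And>n p k0 x y. \<lbrakk>n \<ge> 1; \<forall>k. 0 < p k \<and> p k \<le> 1;
      favourable (\<delta> / 2) (\<delta> / 2) (\<delta>\<^sup>2 / 2) \<delta> p n k0; x \<in> words m n; y \<in> words m n; k0 < n;
      \<forall>k<k0. x ! k = y ! k; x ! k0 \<noteq> y ! k0\<rbrakk> \<Longrightarrow> separated (exp (- C * real n powr (1/3))) m n p x y"
    by (rule separated_if_favourable[OF pos, of m]) (erule that)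
  obtain C' where C': "C' > 0" and rec: "\<And>n p. \<lbrakk>n \<ge> 1;
      \<forall>x\<in>words m n. \<forall>y\<in>words m n. x \<noteq> y \<longrightarrow> separated (exp (- C * real n powr (1/3))) m n p x y\<rbrakk>
      \<Longrightarrow> reconstructible \<epsilon> m n p (nat \<lceil>exp (C' * real n powr (1/3))\<rceil>)"
    by (rule reconstructible_if_separated[OF \<open>\<epsilon> > 0\<close> \<open>m \<ge> 1\<close> less_imp_le[OF C]]) (erule that)
  show "\<exists>C>0. \<forall>p. (\<forall>k. 0 < p k \<and> p k \<le> 1) \<and> (\<forall>k l. k > l \<longrightarrow> p l > p k / 2 + \<delta>) \<and> (\<forall>k>0. p k > \<delta>) \<longrightarrow>
      (\<forall>n\<ge>1. reconstructible \<epsilon> m n p (nat \<lceil>exp (C * real n powr (1/3))\<rceil>))"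
  proof (intro exI[of _ C'] conjI allI impI C')
    fix p :: "nat \<Rightarrow> real" and n :: nat
    assume p: "(\<forall>k. 0 < p k \<and> p k \<le> 1) \<and> (\<forall>k l. k > l \<longrightarrow> p l > p k / 2 + \<delta>) \<and> (\<forall>k>0. p k > \<delta>)" and n: "n \<ge> 1"
    show "reconstructible \<epsilon> m n p (nat \<lceil>exp (C' * real n powr (1/3))\<rceil>)"
    proof (rule rec[OF n], intro ballI impI)
      fix x y assume xy: "x \<in> words m n" "y \<in> words m n" "x \<noteq> y"
      obtain k where k: "k < n" "\<And>l. l < k \<Longrightarrow> x ! l = y ! l" "x ! k \<noteq> y ! k"
        using first_difference[OF xy] by blast
      have "favourable (\<delta> / 2) (\<delta> / 2) (\<delta>\<^sup>2 / 2) \<delta> p n k"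
        by (rule favourable_if_dominating) (use \<delta> p k in auto)
      then show "separated (exp (- C * real n powr (1/3))) m n p x y"
        using sep[OF n _ _ xy(1,2) k(1)] k p by blast
    qed
  qed
next
  have "m \<ge> 1" using assms by simp
  fix q q' :: real assume q: "0 \<le> q \<and> q < 1 \<and> 0 \<le> q' \<and> q' < 1"
  let ?p = "\<lambda>k::nat. 1 - (if even k then q else q')"
  have p: "\<forall>k. 0 < ?p k \<and> ?p k \<le> 1" using q by auto
  let ?sep = "\<lambda>C e. \<forall>n\<ge>1. \<forall>k0 x y. x \<in> words m n \<longrightarrow> y \<in> words m n \<longrightarrow> k0 < n \<longrightarrow> even k0 = e \<longrightarrow>
      (\<forall>k<k0. x ! k = y ! k) \<longrightarrow> x ! k0 \<noteq> y ! k0 \<longrightarrow> separated (exp (- C * real n powr (1/3))) m n ?p x y"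
  \<comment> \<open>The two parities of the first difference lead to different constants.\<close>
  have sep_parity: "\<exists>C>0. ?sep C e" for e
  proof -
    define r s where "r = (if e then 1 - q else 1 - q')" and "s = (if e then 1 - q' else 1 - q)"
    have rs: "0 < r" "r \<le> 1" "0 < s" "s \<le> 1" using q by (auto simp: r_def s_def)
    obtain b0 d c \<eta> where pos: "b0 > 0" "d > 0" "c > 0" "\<eta> > 0" and
      fav: "\<And>p n k0. \<lbrakk>k0 < n; \<forall>l\<ge>k0. p l = (if even (l - k0) then r else s)\<rbrakk>
        \<Longrightarrow> favourable b0 d c \<eta> p n k0"
      by (rule favourable_if_alternating[OF rs]) (erule that)
    have fav_p: "favourable b0 d c \<eta> ?p n k0" if "k0 < n" "even k0 = e" for n k0
      by (rule fav[OF that(1)]) (use that(2) in \<open>auto simp: r_def s_def\<close>)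
    obtain C where "C > 0" and sep: "\<And>n p k0 x y. \<lbrakk>n \<ge> 1; \<forall>k. 0 < p k \<and> p k \<le> 1;
        favourable b0 d c \<eta> p n k0; x \<in> words m n; y \<in> words m n; k0 < n; \<forall>k<k0. x ! k = y ! k;
        x ! k0 \<noteq> y ! k0\<rbrakk> \<Longrightarrow> separated (exp (- C * real n powr (1/3))) m n p x y"
      by (rule separated_if_favourable[OF pos, of m]) (erule that)
    show ?thesis
    proof (intro exI[of _ C] conjI allI impI \<open>C > 0\<close>)
      fix n k0 x y
      assume n: "1 \<le> n" and xy: "x \<in> words m n" "y \<in> words m n" and k0: "k0 < n" "even k0 = e"
        and diff: "\<forall>k<k0. x ! k = y ! k" "x ! k0 \<noteq> y ! k0"
      show "separated (exp (- C * real n powr (1/3))) m n ?p x y"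
        by (rule sep[OF n p fav_p[OF k0] xy k0(1) diff])
    qed
  qed
  obtain C1 where C1: "C1 > 0" "?sep C1 True" using sep_parity by blast
  obtain C2 where C2: "C2 > 0" "?sep C2 False" using sep_parity by blast
  define C where "C = max C1 C2"
  have "C \<ge> 0" using C1 by (simp add: C_def)
  obtain C' where C': "C' > 0" and rec: "\<And>n p. \<lbrakk>n \<ge> 1;
      \<forall>x\<in>words m n. \<forall>y\<in>words m n. x \<noteq> y \<longrightarrow> separated (exp (- C * real n powr (1/3))) m n p x y\<rbrakk>
      \<Longrightarrow> reconstructible \<epsilon> m n p (nat \<lceil>exp (C' * real n powr (1/3))\<rceil>)"
    by (rule reconstructible_if_separated[OF \<open>\<epsilon> > 0\<close> \<open>m \<ge> 1\<close> \<open>C \<ge> 0\<close>]) (erule that)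
  show "\<exists>C>0. \<forall>n\<ge>1. reconstructible \<epsilon> m n ?p (nat \<lceil>exp (C * real n powr (1/3))\<rceil>)"
  proof (intro exI[of _ C'] conjI allI impI C')
    fix n :: nat assume n: "n \<ge> 1"
    show "reconstructible \<epsilon> m n ?p (nat \<lceil>exp (C' * real n powr (1/3))\<rceil>)"
    proof (rule rec[OF n], intro ballI impI)
      fix x y assume xy: "x \<in> words m n" "y \<in> words m n" "x \<noteq> y"
      obtain k where k: "k < n" "\<And>l. l < k \<Longrightarrow> x ! l = y ! l" "x ! k \<noteq> y ! k"
        using first_difference[OF xy] by blast
      have le: "exp (- C * real n powr (1/3)) \<le> exp (- C1 * real n powr (1/3))"
        "exp (- C * real n powr (1/3)) \<le> exp (- C2 * real n powr (1/3))"
        by (simp_all add: C_def mult_right_mono)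
      show "separated (exp (- C * real n powr (1/3))) m n ?p x y"
      proof (cases "even k")
        case True
        then have "separated (exp (- C1 * real n powr (1/3))) m n ?p x y"
          using C1(2) n xy(1,2) k by blast
        then show ?thesis using le(1) by (rule separated_antimono)
      next
        case False
        then have "separated (exp (- C2 * real n powr (1/3))) m n ?p x y"
          using C2(2) n xy(1,2) k by blast
        then show ?thesis using le(2) by (rule separated_antimono)
      qed
    qed
  qed
qed

end
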